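(* Let $f(z)=z+az^{m+1}$ with $m\ge 1$ an integer and $a\in\mathbb{C}$, $a\ne 0$. Let $\mathbf{v}_j$ be an attraction vector of $f$ at $0$, let $\mathcal{A}_j=\mathcal{A}(0,\mathbf{v}_j)$ be the associated parabolic basin of attraction, let $\Omega_j$ be the immediate basin of $\mathcal{A}_j$, and let $\mathcal{P}_j$ be an attracting petal for $f$ for the vector $\mathbf{v}_j$ at $0$. Let $C>0$ be an arbitrary constant and let $q\in\mathcal{P}_j$ be a point lying on the ray $\{t\mathbf{v}_j:t>0\}$. Then there exists a point $z_0\in\Omega_j$ such that for every $$\tilde q\in Q:=\Big(\bigcup_{l,k\ge 0} f^{-l}\big(f^{k}(q)\big)\Big)\cap\Omega_j ,$$ where $l,k$ range over the non-negative integers, the Kobayashi distance satisfies $d_{\Omega_j}(z_0,\tilde q)\ge C$.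
   Context: $f^k$ denotes the $k$-fold iterate of $f$ and $f^{-l}(w)=\{z\in\mathbb{C}: f^l(z)=w\}$ (with $f^0=\mathrm{id}$). Attraction vector: a complex number $\mathbf{v}$ is an attraction vector of $f$ at $0$ if $ma\mathbf{v}^m=-1$; there are $m$ of them. Parabolic basin: $\mathcal{A}(0,\mathbf{v}_j)$ is the set of all $z_0\in\mathbb{C}$ whose orbit $z_k=f^k(z_0)$ converges to $0$ with no $z_k$ equal to $0$, and from the direction $\mathbf{v}_j$, i.e. $z_k\sim \mathbf{v}_j/\sqrt[m]{k}$ as $k\to\infty$ (that is, $\lim_{k\to\infty}\sqrt[m]{k}\,z_k=\mathbf{v}_j$). Immediate basin: $\Omega_j$ is the unique connected component of $\mathcal{A}_j$ that is mapped into itself by $f$. Attracting petal: let $N$ be a neighborhood of $0$ on which $f$ is univalent. An open set $\mathcal{P}_j\subset N$ is an attracting petal for $f$ for the vector $\mathbf{v}_j$ at $0$ if (1) $f(\mathcal{P}_j)\subset\mathcal{P}_j$, and (2) an orbit $z_0\mapsto z_1\mapsto\cdots$ under $f$ is eventually absorbed by $\mathcal{P}_j$ if and only if it converges to $0$ from the direction $\mathbf{v}_j$. Kobayashi metric and distance: let $\Delta$ be the open unit disk. For a domain $\Omega\subset\mathbb{C}$, $z\in\Omega$ and $\xi\in\mathbb{C}$, put $F_\Omega(z,\xi)=\inf\{\lambda>0:\ \exists\, g:\Delta\to\Omega \text{ holomorphic with } g(0)=z,\ \lambda g'(0)=\xi\}$. The length of a piecewise smooth curve $\gamma:[0,1]\to\Omega$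 is $L_\Omega(\gamma)=\int_0^1F_\Omega(\gamma(t),\gamma'(t))\,dt$, and $d_\Omega(z_1,z_2)=\inf L_\Omega(\gamma)$ over piecewise smooth curves $\gamma$ in $\Omega$ joining $z_1$ to $z_2$. *)

theory Defs
  imports "HOL-Complex_Analysis.Complex_Analysis"
begin

definition attraction_vector :: "complex \<Rightarrow> nat \<Rightarrow> complex \<Rightarrow> bool" where
  "attraction_vector a m v \<longleftrightarrow> of_nat m * a * v ^ m = -1"

definition converges_from_direction ::
  "(complex \<Rightarrow> complex) \<Rightarrow> nat \<Rightarrow> complex \<Rightarrow> complex \<Rightarrow> bool" where
  "converges_from_direction f m v z \<longleftrightarrow>
     (\<lambda>k. (f ^^ k) z) \<longlonglongrightarrow> 0 \<and>
     (\<lambda>k. of_real (root m (real k)) * (f ^^ k) z) \<longlonglongrightarrow> v"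

definition parabolic_basin :: "(complex \<Rightarrow> complex) \<Rightarrow> nat \<Rightarrow> complex \<Rightarrow> complex set" where
  "parabolic_basin f m v =
     {z. (\<forall>k. (f ^^ k) z \<noteq> 0) \<and> converges_from_direction f m v z}"

(* A predicate rather than a description operator: uniqueness of the invariant component is a
   fact about parabolic basins and is not built in, so a statement about every \<Omega> with this
   property covers the immediate basin without presupposing uniqueness. *)
definition immediate_basin ::
  "(complex \<Rightarrow> complex) \<Rightarrow> nat \<Rightarrow> complex \<Rightarrow> complex set \<Rightarrow> bool" where
  "immediate_basin f m v \<Omega> \<longleftrightarrow> \<Omega> \<in> components (parabolic_basin f m v) \<and> f ` \<Omega> \<subseteq> \<Omega>"

definition attracting_petal ::
  "(complex \<Rightarrow> complex) \<Rightarrow> nat \<Rightarrow> complex \<Rightarrow> complex set \<Rightarrow> bool" where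
  "attracting_petal f m v P \<longleftrightarrow>
     (\<exists>N. open N \<and> 0 \<in> N \<and> f holomorphic_on N \<and> inj_on f N \<and> P \<subseteq> N) \<and>
     open P \<and> f ` P \<subseteq> P \<and>
     (\<forall>z. (\<exists>K. \<forall>k\<ge>K. (f ^^ k) z \<in> P) \<longleftrightarrow> converges_from_direction f m v z)"

(* For open \<Omega> and z in \<Omega> the set of admissible radii is nonempty (affine discs) and bounded
   below by 0, so the real infimum is the intended one. *)
definition kobayashi_metric :: "complex set \<Rightarrow> complex \<Rightarrow> complex \<Rightarrow> real" where
  "kobayashi_metric \<Omega> z \<xi> =
     Inf {r. r > 0 \<and> (\<exists>g. g holomorphic_on ball 0 1 \<and> g ` ball 0 1 \<subseteq> \<Omega> \<and>
                          g 0 = z \<and> of_real r * deriv g 0 = \<xi>)}"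

(* The integral is taken in [0, \<infinity>], so no integrability side condition arises. Derivatives at the
   finitely many break points of a piecewise C1 path do not affect its value. *)
definition kobayashi_length :: "complex set \<Rightarrow> (real \<Rightarrow> complex) \<Rightarrow> ennreal" where
  "kobayashi_length \<Omega> \<gamma> =
     (\<integral>\<^sup>+ t\<in>{0..1}. ennreal (kobayashi_metric \<Omega> (\<gamma> t)
                             (vector_derivative \<gamma> (at t within {0..1}))) \<partial>lborel)"

definition kobayashi_dist :: "complex set \<Rightarrow> complex \<Rightarrow> complex \<Rightarrow> ennreal" where
  "kobayashi_dist \<Omega> z w =
     (INF \<gamma> \<in> {\<gamma>. valid_path \<gamma> \<and> path_image \<gamma> \<subseteq> \<Omega> \<and> pathstart \<gamma> = z \<and> pathfinish \<gamma> = w}.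
        kobayashi_length \<Omega> \<gamma>)"

end

theory Submission
  imports Defs
begin

text \<open>
  In the coordinate \<open>W = (v / z) ^ m\<close> the map becomes \<open>W \<mapsto> W + 1 + O(1 / W)\<close> with real coefficients,
  so every half-plane \<open>Re (exp (-i\<beta>) W) > R\<close> with \<open>\<bar>\<beta>\<bar> < \<pi> / 2\<close> and \<open>R\<close> large, and also its part in
  the upper half-plane, is forward invariant. Its image in the \<open>z\<close>-plane lies in \<open>\<Omega>\<close>. Since \<open>q\<close> is
  on the attracting ray, its orbit has real \<open>W\<close>, so no point of \<open>Q\<close> lies in the invariant upper part.

  On the rays where \<open>W < 0\<close> the modulus increases under \<open>f\<close>, so \<open>\<Omega>\<close> lies in the sector
  \<open>\<bar>Arg (z / v)\<bar> < \<pi> / m\<close>, which \<open>X = -(m / 2) Ln (z / v)\<close> maps to the strip \<open>\<bar>Im X\<bar> < \<pi> / 2\<close>. By the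
  Schwarz lemma the Kobayashi metric dominates that of the strip. Take \<open>z0\<close> with \<open>Im X\<close> close to
  \<open>\<pi> / 2\<close> and \<open>Re X\<close> large. A path of length less than \<open>C\<close> from \<open>z0\<close> can change neither \<open>Re X\<close> nor
  \<open>ln (\<pi> / 2 - Im X)\<close> by much, so it ends in the upper part of such a half-plane.
\<close>

subsection \<open>Lower bounds for the Kobayashi distance\<close>

text \<open>The Cayley transform \<open>\<phi>\<close> carries the right half-plane to the unit disc
  and \<open>k 0\<close> to the origin, so the Schwarz lemma bounds
  \<open>deriv \<phi> 0 = deriv k 0 / (2 * Re (k 0))\<close> by 1.\<close>

lemma norm_deriv_le_of_Re_pos:
  assumes hol: "k holomorphic_on ball 0 1" and pos: "\<And>z. z \<in> ball 0 1 \<Longrightarrow> Re (k z) > 0"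
  shows "norm (deriv k 0) \<le> 2 * Re (k 0)"
proof -
  define w where "w = k 0"
  define \<phi> where "\<phi> = (\<lambda>z. (k z - w) / (k z + cnj w))"
  have w: "Re w > 0" using pos[of 0] by (simp add: w_def)
  have nz: "k z + cnj w \<noteq> 0" if "z \<in> ball 0 1" for z
    using pos[OF that] w by (auto simp: complex_eq_iff)
  have holphi: "\<phi> holomorphic_on ball 0 1"
    unfolding \<phi>_def using nz by (intro holomorphic_intros hol) auto
  have small: "norm (\<phi> z) < 1" if "norm z < 1" for z
  proof -
    have z: "z \<in> ball 0 1" using that by simp
    \<comment> \<open>The squared norms of denominator and numerator of \<open>\<phi>\<close> differ
      by four times this product.\<close>
    have "Re (k z) * Re w > 0" using pos[OF z] w by simp
    then have "(norm (k z - w))\<^sup>2 < (norm (k z + cnj w))\<^sup>2"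
      unfolding cmod_power2 by (simp add: power2_eq_square algebra_simps)
    then have "norm (k z - w) < norm (k z + cnj w)"
      by (rule power2_less_imp_less) simp
    then show ?thesis using nz[OF z] by (simp add: \<phi>_def norm_divide divide_simps)
  qed
  have dk: "(k has_field_derivative deriv k 0) (at 0)"
    using hol by (intro holomorphic_derivI[of _ "ball 0 1"]) auto
  have "(\<phi> has_field_derivative ((deriv k 0 - 0) * (k 0 + cnj w) - (k 0 - w) * (deriv k 0 + 0)) /
      ((k 0 + cnj w) * (k 0 + cnj w))) (at 0)"
    unfolding \<phi>_def by (intro DERIV_divide DERIV_diff DERIV_add dk DERIV_const nz) simp
  then have "(\<phi> has_field_derivative deriv k 0 / (w + cnj w)) (at 0)"
    using nz[of 0] by (simp add: w_def)
  then have d: "deriv \<phi> 0 = deriv k 0 / (w + cnj w)" by (rule DERIV_imp_deriv)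
  have "norm (deriv \<phi> 0) \<le> 1"
    by (rule Schwarz_Lemma(2)[OF holphi _ small, of 0]) (auto simp: \<phi>_def w_def)
  moreover have "w + cnj w = of_real (2 * Re w)" by (simp add: complex_eq_iff)
  ultimately show ?thesis using w unfolding d
    by (simp add: norm_divide norm_mult w_def[symmetric] divide_simps del: of_real_mult split: if_splits)
qed

text \<open>A real infimum is bounded below by a bound on its elements only if the set is nonempty.
  Openness of \<open>\<Omega>\<close> supplies an affine disc through \<open>z\<close> in direction
  \<open>\<xi>\<close> as a member.\<close>

lemma kobayashi_metric_geI:
  assumes "open \<Omega>" "z \<in> \<Omega>"
    and B: "\<And>r g. \<lbrakk>r > 0; g holomorphic_on ball 0 1; g ` ball 0 1 \<subseteq> \<Omega>; g 0 = z;
                of_real r * deriv g 0 = \<xi>\<rbrakk> \<Longrightarrow> B \<le> r"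
  shows "B \<le> kobayashi_metric \<Omega> z \<xi>"
  unfolding kobayashi_metric_def
proof (rule cInf_greatest)
  obtain e where e: "e > 0" "ball z e \<subseteq> \<Omega>" using assms openE by blast
  \<comment> \<open>The summand 1 keeps the denominator positive when \<open>\<xi> = 0\<close>; the
    admissible radius obtained is \<open>1 / \<rho>\<close>.\<close>
  define \<rho> where "\<rho> = e / (norm \<xi> + 1)"
  have \<rho>: "\<rho> > 0" using e by (simp add: \<rho>_def add_nonneg_pos)
  have "\<rho> * norm \<xi> \<le> \<rho> * (norm \<xi> + 1)" using \<rho> by (intro mult_left_mono) auto
  also have "\<dots> = e" using add_nonneg_pos[OF norm_ge_zero[of \<xi>], of 1] by (simp add: \<rho>_def)
  finally have \<rho>e: "\<rho> * norm \<xi> \<le> e" .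
  define g where "g = (\<lambda>u. z + u * (of_real \<rho> * \<xi>))"
  have "(g has_field_derivative of_real \<rho> * \<xi>) (at 0)"
    unfolding g_def by (auto intro!: derivative_eq_intros)
  then have "deriv g 0 = of_real \<rho> * \<xi>" by (rule DERIV_imp_deriv)
  moreover have "g holomorphic_on ball 0 1" unfolding g_def by (intro holomorphic_intros)
  moreover have "g ` ball 0 1 \<subseteq> \<Omega>"
  proof clarify
    fix u :: complex assume "u \<in> ball 0 1"
    then have u: "norm u < 1" by simp
    have "norm u * (\<rho> * norm \<xi>) < e"
    proof (cases "\<xi> = 0")
      case False
      then have "norm u * (\<rho> * norm \<xi>) < 1 * (\<rho> * norm \<xi>)"
        using u \<rho> by (intro mult_strict_right_mono) auto
      then show ?thesis using \<rho>e by simp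
    qed (use e in auto)
    then have "g u \<in> ball z e"
      using \<rho> by (simp add: g_def dist_norm norm_mult)
    then show "g u \<in> \<Omega>" using e by auto
  qed
  ultimately show "{r. r > 0 \<and> (\<exists>g. g holomorphic_on ball 0 1 \<and> g ` ball 0 1 \<subseteq> \<Omega> \<and>
                          g 0 = z \<and> of_real r * deriv g 0 = \<xi>)} \<noteq> {}"
    using \<rho> by (auto intro!: exI[of _ "1/\<rho>"] exI[of _ g] simp: g_def)
qed (use B in auto)

text \<open>The left-hand side is the pullback under \<open>X\<close> of the hyperbolic metric of
  the strip. Since \<open>exp\<close> maps the strip to the right half-plane, the derivative bound
  applies to \<open>exp (X (g u))\<close>, and the factor \<open>norm (exp (X z))\<close> cancels on
  both sides.\<close>

lemma kobayashi_metric_ge_strip: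
  assumes "open \<Omega>" "z \<in> \<Omega>" and X: "X holomorphic_on \<Omega>"
    and strip: "\<And>z. z \<in> \<Omega> \<Longrightarrow> \<bar>Im (X z)\<bar> < pi / 2"
  shows "norm (deriv X z * \<xi>) / (2 * cos (Im (X z))) \<le> kobayashi_metric \<Omega> z \<xi>"
proof (rule kobayashi_metric_geI)
  fix r g
  assume g: "r > 0" "g holomorphic_on ball 0 1" "g ` ball 0 1 \<subseteq> \<Omega>" "g 0 = z"
    "of_real r * deriv g 0 = \<xi>"
  have cos: "cos (Im (X w)) > 0" if "w \<in> \<Omega>" for w
    using strip[OF that] by (intro cos_gt_zero_pi) auto
  define k where "k = (\<lambda>u. exp (X (g u)))"
  have hk: "k holomorphic_on ball 0 1" unfolding k_def
    using holomorphic_on_compose_gen[OF g(2) X g(3)]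
    by (intro holomorphic_intros) (simp add: o_def)
  have "Re (k u) > 0" if "u \<in> ball 0 1" for u
    using cos[of "g u"] that g(3) by (simp add: k_def Re_exp image_subset_iff)
  then have "norm (deriv k 0) \<le> 2 * Re (k 0)" by (rule norm_deriv_le_of_Re_pos[OF hk])
  moreover have "(k has_field_derivative exp (X z) * (deriv X z * deriv g 0)) (at 0)"
  proof -
    have "(g has_field_derivative deriv g 0) (at 0)"
      using g(2) by (intro holomorphic_derivI[of _ "ball 0 1"]) auto
    moreover have "(X has_field_derivative deriv X z) (at (g 0))"
      using assms g(4) by (auto intro!: holomorphic_derivI[of _ \<Omega>])
    ultimately have "(X \<circ> g has_field_derivative deriv X z * deriv g 0) (at 0)"
      by (rule DERIV_chain[rotated])
    then show ?thesis unfolding k_def o_def using g(4)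
      by (auto intro!: derivative_eq_intros)
  qed
  ultimately have "norm (exp (X z) * (deriv X z * deriv g 0)) \<le> 2 * Re (exp (X z))"
    using g(4) by (simp add: DERIV_imp_deriv k_def)
  then have "norm (deriv X z * deriv g 0) \<le> 2 * cos (Im (X z))"
    by (simp add: norm_mult Re_exp)
  then have "r * norm (deriv X z * deriv g 0) \<le> r * (2 * cos (Im (X z)))"
    using g(1) by (intro mult_left_mono) auto
  then show "norm (deriv X z * \<xi>) / (2 * cos (Im (X z))) \<le> r"
    using cos[OF assms(2)] g(1) by (simp add: g(5)[symmetric] norm_mult divide_simps mult_ac)
qed (use assms in auto)

text \<open>The derivative need not be absolutely integrable here: it may blow up at the points of
  \<open>T\<close>, and then the right-hand side may be infinite.\<close>
lemma nn_integral_abs_deriv_ge: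
  fixes p p' :: "real \<Rightarrow> real"
  assumes "finite T" and cont: "continuous_on {0..1} p"
    and deriv: "\<And>t. t \<in> {0..1} - T \<Longrightarrow> (p has_real_derivative p' t) (at t)"
    and cont': "continuous_on ({0..1} - T) p'"
  shows "ennreal \<bar>p 1 - p 0\<bar> \<le> (\<integral>\<^sup>+ t\<in>{0..1}. ennreal \<bar>p' t\<bar> \<partial>lborel)"
proof -
  \<comment> \<open>Cutting \<open>p'\<close> off outside the set where it is known to be continuous
    gives a Borel function on the whole line.\<close>
  define q where "q = (\<lambda>t. indicator ({0..1} - T) t *\<^sub>R p' t)"
  have meas: "{0..1} - T \<in> sets borel"
    by (rule sets.Diff) (use \<open>finite T\<close> in \<open>auto intro: borel_closed finite_imp_closed\<close>)
  have qm: "q \<in> borel_measurable borel"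
    unfolding q_def using borel_measurable_continuous_on_indicator[OF meas cont'] .
  have AE: "AE t in lborel. t \<notin> T"
    using \<open>finite T\<close> by (intro AE_not_in finite_imp_null_set_lborel)
  have eq: "(\<integral>\<^sup>+ t\<in>{0..1}. ennreal \<bar>p' t\<bar> \<partial>lborel) = (\<integral>\<^sup>+ t. ennreal (norm (q t)) \<partial>lborel)"
    by (intro nn_integral_cong_AE eventually_mono[OF AE]) (auto simp: q_def indicator_def)
  show ?thesis
  proof (cases "(\<integral>\<^sup>+ t. ennreal (norm (q t)) \<partial>lborel) = \<infinity>")
    case False
    then have int: "integrable lborel q"
      using qm by (intro integrableI_bounded) (auto simp: less_top)
    \<comment> \<open>The fundamental theorem holds for the gauge integral without integrability
      assumptions; since \<open>q\<close> is Lebesgue integrable in this case, both integrals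
      agree.\<close>
    have "(p' has_integral p 1 - p 0) {0..1}"
      using deriv cont
      by (intro fundamental_theorem_of_calculus_interior_strong[OF \<open>finite T\<close>])
        (auto simp: has_real_derivative_iff_has_vector_derivative)
    then have "(q has_integral p 1 - p 0) {0..1}"
      by (rule has_integral_spike_finite[OF \<open>finite T\<close>, rotated]) (auto simp: q_def)
    then have "((\<lambda>t. if t \<in> {0..1} then q t else 0) has_integral p 1 - p 0) UNIV"
      by (simp only: has_integral_restrict_UNIV)
    moreover have "(\<lambda>t. if t \<in> {0..1} then q t else 0) = q" by (auto simp: q_def fun_eq_iff indicator_def)
    moreover have "(q has_integral integral\<^sup>L lborel q) UNIV"
      using has_integral_integral_lborel[OF int] .
    ultimately have "integral\<^sup>L lborel q = p 1 - p 0" using has_integral_unique by metis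
    then show ?thesis unfolding eq
      using integral_norm_bound_ennreal[OF int] by simp
  qed (use eq in auto)
qed

text \<open>\<open>\<Psi>\<close> is a potential whose differential is dominated by the hyperbolic
  metric of the strip. Hence its total change along the image of a path under \<open>X\<close> is at
  most the Kobayashi length of the path.\<close>

lemma kobayashi_length_ge:
  assumes "open \<Omega>" and X: "X holomorphic_on \<Omega>"
    and strip: "\<And>z. z \<in> \<Omega> \<Longrightarrow> \<bar>Im (X z)\<bar> < pi / 2"
    and \<Psi>: "\<And>w. \<bar>Im w\<bar> < pi / 2 \<Longrightarrow> (\<Psi> has_derivative (\<lambda>\<eta>. Re (d w * \<eta>))) (at w)"
    and contd: "continuous_on {w. \<bar>Im w\<bar> < pi / 2} d"
    and d: "\<And>w. \<bar>Im w\<bar> < pi / 2 \<Longrightarrow> norm (d w) \<le> 1 / (2 * cos (Im w))"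
    and "valid_path \<gamma>" and im: "path_image \<gamma> \<subseteq> \<Omega>"
  shows "ennreal \<bar>\<Psi> (X (pathfinish \<gamma>)) - \<Psi> (X (pathstart \<gamma>))\<bar> \<le> kobayashi_length \<Omega> \<gamma>"
proof -
  obtain T D where T: "finite T" "continuous_on {0..1} \<gamma>"
    "\<And>t. t \<in> {0..1} - T \<Longrightarrow> (\<gamma> has_vector_derivative D t) (at t)" "continuous_on ({0..1} - T) D"
    using \<open>valid_path \<gamma>\<close>
    unfolding valid_path_def piecewise_C1_differentiable_on_def C1_differentiable_on_def by blast
  have \<gamma>\<Omega>: "\<gamma> t \<in> \<Omega>" if "t \<in> {0..1}" for t using im that by (auto simp: path_image_def)
  define p where "p = (\<lambda>t. \<Psi> (X (\<gamma> t)))"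
  define p' where "p' = (\<lambda>t. Re (d (X (\<gamma> t)) * (deriv X (\<gamma> t) * D t)))"
  have contX: "continuous_on {0..1} (\<lambda>t. X (\<gamma> t))"
    by (rule continuous_on_compose2[OF holomorphic_on_imp_continuous_on[OF X] T(2)])
      (use \<gamma>\<Omega> in auto)
  have "continuous_on {w. \<bar>Im w\<bar> < pi / 2} \<Psi>"
    using \<Psi> by (intro has_derivative_continuous_on) (auto intro: has_derivative_at_withinI)
  then have "continuous_on {0..1} p"
    unfolding p_def by (rule continuous_on_compose2[OF _ contX]) (use strip \<gamma>\<Omega> in auto)
  moreover have "(p has_real_derivative p' t) (at t)" if t: "t \<in> {0..1} - T" for t
  proof -
    have "(X has_derivative (\<lambda>h. deriv X (\<gamma> t) * h)) (at (\<gamma> t))"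
      using holomorphic_derivI[OF X \<open>open \<Omega>\<close> \<gamma>\<Omega>[of t]] t by (simp add: has_field_derivative_def)
    then have 1: "((\<lambda>t. X (\<gamma> t)) has_derivative (\<lambda>h. deriv X (\<gamma> t) * (h *\<^sub>R D t))) (at t)"
      using T(3)[OF t] unfolding has_vector_derivative_def
      by (intro has_derivative_compose[of \<gamma> _ t UNIV X]) auto
    have "(p has_derivative (\<lambda>h. Re (d (X (\<gamma> t)) * (deriv X (\<gamma> t) * (h *\<^sub>R D t))))) (at t)"
      unfolding p_def
      by (rule has_derivative_compose[OF 1]) (use \<Psi> strip \<gamma>\<Omega> t in auto)
    then show ?thesis unfolding has_field_derivative_def p'_def
      by (rule has_derivative_eq_rhs) (auto simp: fun_eq_iff algebra_simps)
  qed
  moreover have "continuous_on ({0..1} - T) p'"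
  proof -
    have sub: "continuous_on ({0..1} - T) \<gamma>" "continuous_on ({0..1} - T) (\<lambda>t. X (\<gamma> t))"
      using T(2) contX by (auto intro: continuous_on_subset)
    have "continuous_on \<Omega> (deriv X)"
      using holomorphic_deriv[OF X \<open>open \<Omega>\<close>] by (rule holomorphic_on_imp_continuous_on)
    then have "continuous_on ({0..1} - T) (\<lambda>t. deriv X (\<gamma> t))"
      by (rule continuous_on_compose2[OF _ sub(1)]) (use \<gamma>\<Omega> in auto)
    moreover have "continuous_on ({0..1} - T) (\<lambda>t. d (X (\<gamma> t)))"
      by (rule continuous_on_compose2[OF contd sub(2)]) (use \<gamma>\<Omega> strip in auto)
    ultimately show ?thesis unfolding p'_def by (intro continuous_intros T(4))
  qed
  ultimately have "ennreal \<bar>p 1 - p 0\<bar> \<le> (\<integral>\<^sup>+ t\<in>{0..1}. ennreal \<bar>p' t\<bar> \<partial>lborel)"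
    by (intro nn_integral_abs_deriv_ge[OF T(1)])
  also have "\<dots> \<le> kobayashi_length \<Omega> \<gamma>"
    unfolding kobayashi_length_def
  proof (rule nn_integral_mono_AE)
    have AE: "AE t in lborel. t \<notin> T"
      using T(1) by (intro AE_not_in finite_imp_null_set_lborel)
    have "\<bar>p' t\<bar> \<le> kobayashi_metric \<Omega> (\<gamma> t) (vector_derivative \<gamma> (at t within {0..1}))"
      if t: "t \<in> {0..1} - T" for t
    proof -
      have "\<bar>p' t\<bar> \<le> norm (d (X (\<gamma> t))) * norm (deriv X (\<gamma> t) * D t)"
        unfolding p'_def using abs_Re_le_cmod norm_mult by metis
      also have "\<dots> \<le> 1 / (2 * cos (Im (X (\<gamma> t)))) * norm (deriv X (\<gamma> t) * D t)"
        using d[of "X (\<gamma> t)"] strip[OF \<gamma>\<Omega>, of t] t by (intro mult_right_mono) auto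
      also have "\<dots> \<le> kobayashi_metric \<Omega> (\<gamma> t) (D t)"
        using kobayashi_metric_ge_strip[OF \<open>open \<Omega>\<close> \<gamma>\<Omega> X strip, of t "D t"] t by simp
      also have "D t = vector_derivative \<gamma> (at t within {0..1})"
        using vector_derivative_at_within_ivl[OF T(3)[OF t], of 0 1] t by auto
      finally show ?thesis .
    qed
    then show "AE t in lborel. ennreal \<bar>p' t\<bar> * indicator {0..1} t \<le>
      ennreal (kobayashi_metric \<Omega> (\<gamma> t) (vector_derivative \<gamma> (at t within {0..1}))) *
      indicator {0..1} t"
      by (intro eventually_mono[OF AE]) (auto simp: indicator_def intro!: ennreal_leI)
  qed
  finally show ?thesis by (simp add: p_def pathstart_def pathfinish_def)
qed

text \<open>Two potentials are used: half the real part, because \<open>cos\<close> is at most 1,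
  and half the logarithm of the distance to the upper edge, because
  \<open>cos y = sin (pi / 2 - y) \<le> pi / 2 - y\<close>.\<close>

lemma kobayashi_dist_ge_strip:
  assumes "open \<Omega>" "X holomorphic_on \<Omega>" "\<And>z. z \<in> \<Omega> \<Longrightarrow> \<bar>Im (X z)\<bar> < pi / 2"
  shows "ennreal (\<bar>Re (X w) - Re (X z)\<bar> / 2) \<le> kobayashi_dist \<Omega> z w" (is ?Re)
    and "ennreal (\<bar>ln (pi / 2 - Im (X w)) - ln (pi / 2 - Im (X z))\<bar> / 2) \<le> kobayashi_dist \<Omega> z w"
      (is ?Im)
proof -
  have cos: "cos (Im u) > 0" if "\<bar>Im u\<bar> < pi / 2" for u
    using that by (intro cos_gt_zero_pi) auto
  show ?Re unfolding kobayashi_dist_def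
  proof (rule INF_greatest, clarify)
    fix \<gamma> assume \<gamma>: "valid_path \<gamma>" "path_image \<gamma> \<subseteq> \<Omega>"
    have "ennreal \<bar>Re (X (pathfinish \<gamma>)) / 2 - Re (X (pathstart \<gamma>)) / 2\<bar> \<le> kobayashi_length \<Omega> \<gamma>"
    proof (rule kobayashi_length_ge[OF assms, where d = "\<lambda>_. 1 / 2" and \<Psi> = "\<lambda>w. Re w / 2"])
      fix u assume "\<bar>Im u\<bar> < pi / 2"
      then show "norm (1 / 2 :: complex) \<le> 1 / (2 * cos (Im u))"
        using cos[of u] cos_le_one[of "Im u"] by (simp add: norm_divide divide_simps)
      show "((\<lambda>w. Re w / 2) has_derivative (\<lambda>\<eta>. Re (1 / 2 * \<eta>))) (at u)"
        by (auto intro!: derivative_eq_intros)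
    qed (use \<gamma> in auto)
    then show "ennreal (\<bar>Re (X (pathfinish \<gamma>)) - Re (X (pathstart \<gamma>))\<bar> / 2) \<le> kobayashi_length \<Omega> \<gamma>"
      by (simp add: diff_divide_distrib[symmetric])
  qed
  show ?Im unfolding kobayashi_dist_def
  proof (rule INF_greatest, clarify)
    fix \<gamma> assume \<gamma>: "valid_path \<gamma>" "path_image \<gamma> \<subseteq> \<Omega>"
    \<comment> \<open>As \<open>Re (\<i> * \<eta>) = - Im \<eta>\<close>, multiplication by
      \<open>?d u\<close> followed by \<open>Re\<close> is the differential of
      \<open>?\<Psi>\<close>.\<close>
    let ?d = "\<lambda>u. \<i> / of_real (2 * (pi / 2 - Im u))"
    let ?\<Psi> = "\<lambda>w. ln (pi / 2 - Im w) / 2"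
    have "ennreal \<bar>?\<Psi> (X (pathfinish \<gamma>)) - ?\<Psi> (X (pathstart \<gamma>))\<bar> \<le> kobayashi_length \<Omega> \<gamma>"
    proof (rule kobayashi_length_ge[OF assms, where d = ?d])
      fix u assume u: "\<bar>Im u\<bar> < pi / 2"
      have "cos (Im u) = sin (pi / 2 - Im u)" by (simp add: cos_sin_eq)
      also have "\<dots> \<le> pi / 2 - Im u" using u by (intro sin_x_le_x) auto
      finally have "cos (Im u) \<le> pi / 2 - Im u" .
      moreover have "norm (?d u) = 1 / (2 * (pi / 2 - Im u))"
        unfolding norm_divide norm_of_real using u by simp
      ultimately show "norm (?d u) \<le> 1 / (2 * cos (Im u))"
        using cos[OF u] u by (simp only:) (intro divide_left_mono mult_pos_pos; simp)
      have "((\<lambda>w. ln (pi / 2 - Im w) / 2) has_derivative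
          (\<lambda>\<eta>. - Im \<eta> * inverse (pi / 2 - Im u) / 2)) (at u)"
        using u by (auto intro!: derivative_eq_intros simp: divide_simps)
      moreover have "- Im \<eta> * inverse (pi / 2 - Im u) / 2 = Re (?d u * \<eta>)" for \<eta>
      proof -
        have "?d u * \<eta> = of_real (1 / (2 * (pi / 2 - Im u))) * (\<i> * \<eta>)" by simp
        also have "Re \<dots> = 1 / (2 * (pi / 2 - Im u)) * Re (\<i> * \<eta>)"
          by (simp only: times_complex.sel Re_complex_of_real Im_complex_of_real mult_zero_left diff_zero)
        finally show ?thesis using u by (simp add: field_simps)
      qed
      ultimately show "(?\<Psi> has_derivative (\<lambda>\<eta>. Re (?d u * \<eta>))) (at u)" by (simp only:)
    next
      show "continuous_on {w. \<bar>Im w\<bar> < pi / 2} ?d"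
        by (intro continuous_intros) (auto simp: complex_eq_iff)
    qed (use \<gamma> in auto)
    then show "ennreal (\<bar>ln (pi / 2 - Im (X (pathfinish \<gamma>))) - ln (pi / 2 - Im (X (pathstart \<gamma>)))\<bar> / 2)
        \<le> kobayashi_length \<Omega> \<gamma>"
      by (simp add: diff_divide_distrib[symmetric])
  qed
qed

subsection \<open>The step in the coordinate at infinity\<close>

text \<open>This is the map \<open>f\<close> in the coordinate \<open>W = (v / z) ^ m\<close>, where
  \<open>f z = z * (1 - 1 / (m * W))\<close>.\<close>

definition fatou_step :: "nat \<Rightarrow> complex \<Rightarrow> complex" where
  "fatou_step m W = W / (1 - 1 / (of_nat m * W)) ^ m"

text \<open>The inward normal is \<open>cis \<beta>\<close>. Tilting it towards the imaginary axis
  brings in points with argument close to \<open>pi\<close>.\<close>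

definition half_plane :: "real \<Rightarrow> real \<Rightarrow> complex set" where
  "half_plane \<beta> R = {W. R < Re (cis (-\<beta>) * W)}"

text \<open>The inverse branch of \<open>W = (v / z) ^ m\<close> that sends the positive axis to the
  ray through \<open>v\<close>.\<close>

definition petal_chart :: "nat \<Rightarrow> complex \<Rightarrow> complex \<Rightarrow> complex" where
  "petal_chart m v W = v * exp (- Ln W / of_nat m)"

text \<open>With \<open>u = 1 / W\<close> the increment is the difference quotient at 0 of
  \<open>(1 - u / m) ^ (-m)\<close>, whose derivative there is 1.\<close>

lemma fatou_step_asymp:
  assumes "m \<ge> 1"
  shows "((\<lambda>W. fatou_step m W - W) \<longlongrightarrow> 1) at_infinity"
proof -
  define g where "g = (\<lambda>u::complex. inverse ((1 - u / of_nat m) ^ m))"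
  have "(g has_field_derivative 1) (at 0)"
    unfolding g_def using assms by (auto intro!: derivative_eq_intros)
  then have "((\<lambda>u. (g u - 1) / u) \<longlongrightarrow> 1) (at 0)"
    by (simp add: DERIV_def g_def)
  then have lim: "((\<lambda>W. (g (inverse W) - 1) / inverse W) \<longlongrightarrow> 1) at_infinity"
    by (rule filterlim_compose)
      (auto simp: filterlim_at tendsto_inverse_0 intro!: eventually_not_equal_at_infinity)
  have "eventually (\<lambda>W::complex. W \<noteq> 0) at_infinity" by (rule eventually_not_equal_at_infinity)
  then have ev: "eventually (\<lambda>W. (g (inverse W) - 1) / inverse W = fatou_step m W - W) at_infinity"
    by eventually_elim (simp add: g_def fatou_step_def field_simps)
  show ?thesis using lim by (rule Lim_transform_eventually) (rule ev)
qed

lemma Im_inverse_neg_iff: "Im (inverse z) < 0 \<longleftrightarrow> Im z > 0"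
proof (cases "z = 0")
  case False
  then have "(Re z)\<^sup>2 + (Im z)\<^sup>2 > 0" by (simp add: complex_neq_0)
  then show ?thesis by (auto simp: divide_less_0_iff zero_less_divide_iff)
qed simp

text \<open>In the coordinate \<open>u = 1 / W\<close> the step is a polynomial with real coefficients and
  derivative \<open>1\<close> at \<open>0\<close>, so its imaginary part increases along short vertical segments
  from the real axis.\<close>
lemma eventually_Im_fatou_step_pos:
  assumes "m \<ge> 1"
  shows "eventually (\<lambda>W. Im W > 0 \<longrightarrow> Im (fatou_step m W) > 0) at_infinity"
proof -
  define p where "p = (\<lambda>u::complex. u * (1 - u / of_nat m) ^ m)"
  define p' where "p' = (\<lambda>u::complex. (1 - u / of_nat m) ^ m - u * (1 - u / of_nat m) ^ (m - 1))"
  have dp: "(p has_field_derivative p' u) (at u)" for u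
    unfolding p_def p'_def using assms by (auto intro!: derivative_eq_intros)
  have "isCont p' 0"
    unfolding p'_def by (intro continuous_intros) (use assms in auto)
  then have "isCont (\<lambda>u. Re (p' u)) 0" by (rule bounded_linear.isCont[OF bounded_linear_Re])
  then have "((\<lambda>u. Re (p' u)) \<longlongrightarrow> Re (p' 0)) (nhds 0)"
    unfolding isCont_def by (subst (asm) tendsto_at_iff_tendsto_nhds)
  then have "eventually (\<lambda>u. Re (p' u) > 0) (nhds 0)"
    by (rule order_tendstoD(1)) (simp add: p'_def)
  then obtain r where r: "r > 0" "\<And>u. norm u < r \<Longrightarrow> Re (p' u) > 0"
    by (auto simp: eventually_nhds_metric)
  have neg: "Im (p u) < 0" if u: "norm u < r" "Im u < 0" for u
  proof -
    define \<phi> where "\<phi> = (\<lambda>t. Im (p (of_real (Re u) + of_real t * \<i>)))"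
    have "\<phi> (Im u) < \<phi> 0"
    proof (rule DERIV_pos_imp_increasing[OF u(2)])
      fix t assume t: "Im u \<le> t" "t \<le> 0"
      let ?w = "of_real (Re u) + of_real t * \<i>"
      have "norm ?w \<le> norm u"
        using t unfolding cmod_def by (auto intro!: add_mono simp: abs_le_square_iff[symmetric])
      then have "Re (p' ?w) > 0" using r u by auto
      moreover have "(\<phi> has_real_derivative Re (p' ?w)) (at t)"
      proof -
        have "((\<lambda>t. p (of_real (Re u) + of_real t * \<i>)) has_vector_derivative (\<i> * p' ?w)) (at t)"
          by (rule field_vector_diff_chain_at[of _ _ _ p, unfolded o_def, OF _ dp])
            (auto intro!: derivative_eq_intros)
        then have "(\<phi> has_vector_derivative Im (\<i> * p' ?w)) (at t)"
          unfolding \<phi>_def by (rule bounded_linear.has_vector_derivative[OF bounded_linear_Im])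
        then show ?thesis by (simp add: has_real_derivative_iff_has_vector_derivative)
      qed
      ultimately show "\<exists>y. (\<phi> has_real_derivative y) (at t) \<and> 0 < y" by blast
    qed
    moreover have "u = of_real (Re u) + of_real (Im u) * \<i>" by (simp add: complex_eq_iff)
    moreover have "p (of_real (Re u)) = of_real (Re u * (1 - Re u / real m) ^ m)"
      by (simp add: p_def)
    ultimately show ?thesis by (simp add: \<phi>_def)
  qed
  have "((\<lambda>W::complex. inverse W) \<longlongrightarrow> 0) at_infinity" by (rule tendsto_inverse_0)
  then have "eventually (\<lambda>W::complex. norm (inverse W) < r) at_infinity"
    using r(1) by (auto dest!: tendstoD simp: dist_norm)
  then show ?thesis
  proof eventually_elim
    case (elim W)
    show ?case
    proof
      assume W: "Im W > 0"
      then have "Im (p (inverse W)) < 0" by (intro neg elim) (simp only: Im_inverse_neg_iff)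
      \<comment> \<open>Inversion exchanges the upper and the lower half-plane, so the sign found
        for \<open>p\<close> is reversed.\<close>
      moreover have "p (inverse W) = inverse (fatou_step m W)"
        using W by (auto simp: p_def fatou_step_def divide_inverse mult.commute)
      ultimately show "Im (fatou_step m W) > 0" by (simp only: Im_inverse_neg_iff)
    qed
  qed
qed

section \<open>Invariant half-planes and the growth of orbits in them\<close>

lemma Re_cis_mult: "Re (cis (-\<beta>) * W) = norm W * cos (Arg W - \<beta>)"
proof (cases "W = 0")
  case False
  have "cis (-\<beta>) * W = of_real (norm W) * cis (Arg W - \<beta>)"
    using False cis_Arg[OF False] by (simp add: sgn_eq cis_mult[symmetric] diff_conv_add_uminus mult_ac
        del: add_uminus_conv_diff)
  then show ?thesis by simp
qed simp

lemma Re_cis_mult_le: "Re (cis (-\<beta>) * W) \<le> norm W"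
  unfolding Re_cis_mult by (intro mult_left_le) auto

text \<open>The cosine of \<open>Arg W - \<beta>\<close> is positive, and the difference is at most
  \<open>3 * pi / 2\<close> in absolute value, so it lies in the central interval of positivity and
  not in a translate by a period.\<close>

lemma half_plane_Arg:
  assumes "R \<ge> 0" "\<bar>\<beta>\<bar> < pi / 2" "W \<in> half_plane \<beta> R"
  shows "W \<noteq> 0" "\<bar>Arg W - \<beta>\<bar> < pi / 2"
proof -
  have pos: "norm W * cos (Arg W - \<beta>) > 0"
    using assms unfolding half_plane_def mem_Collect_eq Re_cis_mult by linarith
  then show "W \<noteq> 0" by auto
  have cos: "cos (\<bar>Arg W - \<beta>\<bar>) > 0" using pos by (simp add: zero_less_mult_iff)
  show "\<bar>Arg W - \<beta>\<bar> < pi / 2"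
  proof (rule ccontr)
    assume "\<not> ?thesis"
    moreover have "\<bar>Arg W - \<beta>\<bar> \<le> 3 * pi / 2"
      using Arg_bounded[of W] assms(2) by linarith
    ultimately have "cos (\<bar>Arg W - \<beta>\<bar> - pi) \<ge> 0" by (intro cos_ge_zero) auto
    then show False using cos by simp
  qed
qed

text \<open>Points of the half-plane have norm above \<open>R\<close>, so finitely many properties
  valid near infinity hold throughout once \<open>R\<close> is large. A single \<open>R\<close>
  serves for invariance, drift, the choice of branch and the upper half-plane.\<close>

lemma half_plane_invariant:
  assumes "m \<ge> 1" "\<bar>\<beta>\<bar> < pi / 2"
  obtains R where "R > 0"
    "\<And>W. W \<in> half_plane \<beta> R \<Longrightarrow> fatou_step m W \<in> half_plane \<beta> R"
    "\<And>W. W \<in> half_plane \<beta> R \<Longrightarrow>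
       Re (cis (-\<beta>) * W) + cos \<beta> / 2 \<le> Re (cis (-\<beta>) * fatou_step m W)"
    "\<And>W. W \<in> half_plane \<beta> R \<Longrightarrow>
       petal_chart m v (fatou_step m W) = petal_chart m v W * (1 - 1 / (of_nat m * W))"
    "\<And>W. W \<in> half_plane \<beta> R \<Longrightarrow> Im W > 0 \<Longrightarrow> Im (fatou_step m W) > 0"
proof -
  have c: "cos \<beta> > 0" using assms by (intro cos_gt_zero_pi) auto
  let ?q = "\<lambda>W::complex. 1 - 1 / (of_nat m * W)"
  have "((\<lambda>W::complex. 1 - inverse W / of_nat m) \<longlongrightarrow> 1 - 0 / of_nat m) at_infinity"
    by (intro tendsto_intros tendsto_inverse_0) (use assms in auto)
  then have lim: "(?q \<longlongrightarrow> 1) at_infinity" by (simp add: divide_inverse inverse_mult_distrib mult.commute)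
  have 1: "eventually (\<lambda>W. norm (fatou_step m W - W - 1) < cos \<beta> / 2) at_infinity"
    using tendstoD[OF fatou_step_asymp[OF assms(1)], of "cos \<beta> / 2"] c by (simp add: dist_norm)
  have 2: "eventually (\<lambda>W. ?q W \<noteq> 0) at_infinity"
    using tendsto_imp_eventually_ne[OF lim, of 0] by simp
  have "((\<lambda>W. of_nat m * Ln (?q W)) \<longlongrightarrow> of_nat m * Ln 1) at_infinity"
    by (intro tendsto_intros lim) auto
  \<comment> \<open>Arguments in the half-plane stay below
    \<open>pi / 2 + \<bar>\<beta>\<bar>\<close>; this tolerance is what remains up to
    \<open>pi\<close>, so a step never crosses the cut of \<open>Ln\<close>.\<close>
  from tendstoD[OF this, of "pi / 2 - \<bar>\<beta>\<bar>"]
  have 3: "eventually (\<lambda>W. norm (of_nat m * Ln (?q W)) < pi / 2 - \<bar>\<beta>\<bar>) at_infinity"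
    using assms by (simp add: dist_norm)
  obtain b where b: "\<And>W. norm W \<ge> b \<Longrightarrow> norm (fatou_step m W - W - 1) < cos \<beta> / 2 \<and> ?q W \<noteq> 0 \<and>
      norm (of_nat m * Ln (?q W)) < pi / 2 - \<bar>\<beta>\<bar> \<and> (Im W > 0 \<longrightarrow> Im (fatou_step m W) > 0)"
    using eventually_conj[OF 1 eventually_conj[OF 2 eventually_conj[OF 3
        eventually_Im_fatou_step_pos[OF assms(1)]]]]
    unfolding eventually_at_infinity by blast
  define R where "R = max b 1"
  have b': "norm (fatou_step m W - W - 1) < cos \<beta> / 2" "?q W \<noteq> 0"
      "norm (of_nat m * Ln (?q W)) < pi / 2 - \<bar>\<beta>\<bar>" "Im W > 0 \<Longrightarrow> Im (fatou_step m W) > 0"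
    if "W \<in> half_plane \<beta> R" for W
  proof -
    have "R < norm W" using that Re_cis_mult_le[of \<beta> W] by (simp add: half_plane_def)
    then show "norm (fatou_step m W - W - 1) < cos \<beta> / 2" "?q W \<noteq> 0"
      "norm (of_nat m * Ln (?q W)) < pi / 2 - \<bar>\<beta>\<bar>" "Im W > 0 \<Longrightarrow> Im (fatou_step m W) > 0"
      using b[of W] by (auto simp: R_def)
  qed
  \<comment> \<open>The translation by 1 advances by \<open>cos \<beta>\<close> along the normal,
    and the error term takes back at most half of it.\<close>
  have gain: "Re (cis (-\<beta>) * W) + cos \<beta> / 2 \<le> Re (cis (-\<beta>) * fatou_step m W)"
    if "W \<in> half_plane \<beta> R" for W
  proof -
    have "\<bar>Re (cis (-\<beta>) * (fatou_step m W - W - 1))\<bar> \<le> norm (cis (-\<beta>) * (fatou_step m W - W - 1))"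
      by (rule abs_Re_le_cmod)
    also have "\<dots> < cos \<beta> / 2" using b'(1)[OF that] by (simp add: norm_mult)
    finally have "- (cos \<beta> / 2) < Re (cis (-\<beta>) * (fatou_step m W - W - 1))" by linarith
    moreover have "\<dots> = Re (cis (-\<beta>) * fatou_step m W) - Re (cis (-\<beta>) * W) - cos \<beta>"
      by (simp add: algebra_simps)
    ultimately show ?thesis by linarith
  qed
  show ?thesis
  proof (rule that)
    show "R > 0" by (simp add: R_def)
  next
    fix W assume W: "W \<in> half_plane \<beta> R"
    show "fatou_step m W \<in> half_plane \<beta> R"
      using gain[OF W] W c by (simp add: half_plane_def)
    show "petal_chart m v (fatou_step m W) = petal_chart m v W * ?q W"
    proof -
      have W0: "W \<noteq> 0" "\<bar>Arg W - \<beta>\<bar> < pi / 2"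
        using half_plane_Arg[OF _ assms(2) W] by (auto simp: R_def)
      have "\<bar>Im (of_nat m * Ln (?q W))\<bar> < pi / 2 - \<bar>\<beta>\<bar>"
        using b'(3)[OF W] abs_Im_le_cmod order.strict_trans1 by blast
      then have Im: "\<bar>Im (Ln W - of_nat m * Ln (?q W))\<bar> < pi"
        using W0(2) abs_triangle_ineq[of "Arg W - \<beta>" \<beta>]
          abs_triangle_ineq4[of "Arg W" "Im (of_nat m * Ln (?q W))"] Arg_eq_Im_Ln[OF W0(1)] by simp
      have "exp (Ln W - of_nat m * Ln (?q W)) = fatou_step m W"
        using W0 b'(2)[OF W] by (simp add: exp_diff exp_of_nat_mult fatou_step_def)
      then have "Ln (fatou_step m W) = Ln W - of_nat m * Ln (?q W)"
        using Im by (intro Ln_unique) auto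
      then have eq: "- Ln (fatou_step m W) / of_nat m = - Ln W / of_nat m + Ln (?q W)"
        using assms by (simp add: field_simps)
      show ?thesis
        unfolding petal_chart_def eq exp_add exp_Ln[OF b'(2)[OF W]] by (simp only: mult.assoc)
    qed
  qed (use gain b' in auto)
qed

text \<open>A Cesaro argument: from some index on, the deviation from \<open>n * c\<close> grows by
  less than \<open>e / 2\<close> per step, and division by \<open>n\<close> absorbs the deviation
  accumulated before.\<close>

lemma quotient_tendsto_of_increment_tendsto:
  fixes X :: "nat \<Rightarrow> 'a :: real_normed_field"
  assumes "(\<lambda>n. X (Suc n) - X n) \<longlonglongrightarrow> c"
  shows "(\<lambda>n. X n / of_nat n) \<longlonglongrightarrow> c"
proof (rule LIMSEQ_I)
  fix e :: real assume "e > 0"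
  obtain N where N: "\<And>n. n \<ge> N \<Longrightarrow> norm (X (Suc n) - X n - c) < e / 2"
    using LIMSEQ_D[OF assms, of "e / 2"] \<open>e > 0\<close> by auto
  define Y where "Y = (\<lambda>n. X n - of_nat n * c)"
  have Y: "norm (Y (N + k)) \<le> norm (Y N) + real k * (e / 2)" for k
  proof (induction k)
    case (Suc k)
    have "Y (N + Suc k) = Y (N + k) + (X (Suc (N + k)) - X (N + k) - c)"
      by (simp add: Y_def algebra_simps)
    then have "norm (Y (N + Suc k)) \<le> norm (Y (N + k)) + norm (X (Suc (N + k)) - X (N + k) - c)"
      by (metis norm_triangle_ineq)
    with N[of "N + k"] Suc show ?case by (simp add: algebra_simps add_divide_distrib)
  qed simp
  obtain M :: nat where M: "real M > 2 * norm (Y N) / e" using reals_Archimedean2 by blast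
  show "\<exists>no. \<forall>n\<ge>no. norm (X n / of_nat n - c) < e"
  proof (intro exI allI impI)
    fix n assume n: "n \<ge> max (max N M) 1"
    have "norm (Y n) \<le> norm (Y N) + real (n - N) * (e / 2)" using Y[of "n - N"] n by simp
    also have "\<dots> \<le> norm (Y N) + real n * (e / 2)"
      using \<open>e > 0\<close> by (intro add_left_mono mult_right_mono) auto
    also have "norm (Y N) < real n * (e / 2)"
      using M n \<open>e > 0\<close> by (auto simp: field_simps intro: order.strict_trans2)
    finally have "norm (Y n) / real n < e" using n by (simp add: pos_divide_less_eq mult.commute)
    moreover have "X n / of_nat n - c = Y n / of_nat n" using n by (simp add: Y_def field_simps)
    ultimately show "norm (X n / of_nat n - c) < e"
      by (simp add: norm_divide)
  qed
qed

text \<open>The drift along the normal forces the orbit to infinity, where the increments tend to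
  1.\<close>

lemma fatou_orbit_asymp:
  assumes "m \<ge> 1" "\<bar>\<beta>\<bar> < pi / 2"
    and inv: "\<And>W. W \<in> half_plane \<beta> R \<Longrightarrow> fatou_step m W \<in> half_plane \<beta> R"
    and gain: "\<And>W. W \<in> half_plane \<beta> R \<Longrightarrow>
       Re (cis (-\<beta>) * W) + cos \<beta> / 2 \<le> Re (cis (-\<beta>) * fatou_step m W)"
    and W: "W \<in> half_plane \<beta> R"
  shows "(\<lambda>n. (fatou_step m ^^ n) W / of_nat n) \<longlonglongrightarrow> 1"
proof -
  have c: "cos \<beta> > 0" using assms by (intro cos_gt_zero_pi) auto
  define X where "X = (\<lambda>n. (fatou_step m ^^ n) W)"
  have X: "X n \<in> half_plane \<beta> R \<and> R + real n * (cos \<beta> / 2) \<le> Re (cis (-\<beta>) * X n)" for n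
  proof (induction n)
    case (Suc n)
    with inv[of "X n"] gain[of "X n"] show ?case by (auto simp: X_def algebra_simps add_divide_distrib)
  qed (use W in \<open>auto simp: X_def half_plane_def\<close>)
  have "filterlim (\<lambda>n. R + real n * (cos \<beta> / 2)) at_top sequentially"
    using c by real_asymp
  then have "filterlim (\<lambda>n. norm (X n)) at_top sequentially"
    by (rule filterlim_at_top_mono) (use X Re_cis_mult_le order_trans in \<open>blast intro: always_eventually\<close>)
  then have "filterlim X at_infinity sequentially"
    by (simp add: filterlim_at_infinity_conv_norm_at_top)
  then have "(\<lambda>n. fatou_step m (X n) - X n) \<longlonglongrightarrow> 1"
    by (rule filterlim_compose[OF fatou_step_asymp[OF assms(1)]])
  then show ?thesis unfolding X_def by (intro quotient_tendsto_of_increment_tendsto) simp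
qed

subsection \<open>The parabolic basin\<close>

lemma of_real_root_eq_exp:
  assumes "m \<ge> 1" "n \<ge> 1"
  shows "complex_of_real (root m (real n)) = exp (of_real (ln (real n)) / of_nat m)"
proof -
  have "root m (real n) = exp (ln (real n) / real m)"
    using assms by (simp add: root_powr_inverse powr_def divide_inverse mult.commute)
  then show ?thesis by (simp add: exp_of_real[symmetric])
qed

lemma Ln_divide_of_nat:
  assumes "n \<ge> 1" "W \<noteq> 0"
  shows "Ln (W / of_nat n) = Ln W - of_real (ln (real n))"
  using Ln_divide_of_real[of "real n" W] assms by simp

lemma petal_chart_holomorphic: "petal_chart m v holomorphic_on - \<real>\<^sub>\<le>\<^sub>0"
proof (cases "m = 0")
  case False
  then show ?thesis unfolding petal_chart_def by (intro holomorphic_intros) auto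
qed (simp add: petal_chart_def[abs_def])

lemma half_plane_not_nonpos_Reals:
  assumes "R \<ge> 0" "\<bar>\<beta>\<bar> < pi / 2"
  shows "half_plane \<beta> R \<subseteq> - \<real>\<^sub>\<le>\<^sub>0"
proof
  fix W assume W: "W \<in> half_plane \<beta> R"
  have "W \<noteq> 0" "\<bar>Arg W\<bar> < pi"
    using half_plane_Arg[OF assms W] assms(2) abs_triangle_ineq[of "Arg W - \<beta>" \<beta>] by auto
  then show "W \<in> - \<real>\<^sub>\<le>\<^sub>0"
    using Arg_eq_pi[of W] by (auto simp: complex_nonpos_Reals_iff complex_eq_iff)
qed

lemma half_plane_eq_halfspace: "half_plane \<beta> R = {W. cis \<beta> \<bullet> W > R}"
  by (auto simp: half_plane_def inner_complex_def)

lemma open_half_plane: "open (half_plane \<beta> R)"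
  unfolding half_plane_eq_halfspace by (rule open_halfspace_gt)

lemma connected_half_plane: "connected (half_plane \<beta> R)"
  unfolding half_plane_eq_halfspace by (intro convex_connected convex_halfspace_gt)

locale parabolic_germ =
  fixes f :: "complex \<Rightarrow> complex" and m :: nat and a v :: complex
  assumes m: "m \<ge> 1" and f: "\<And>z. f z = z + a * z ^ (m + 1)"
    and attr: "attraction_vector a m v"
begin

lemma v_nz: "v \<noteq> 0"
  using attr m by (auto simp: attraction_vector_def power_0_left)

lemma a_v: "a * v ^ m = - 1 / of_nat m"
  using attr m by (simp add: attraction_vector_def field_simps)

text \<open>Since \<open>a * v ^ m = - 1 / m\<close>, the multiplier depends on \<open>z\<close>
  only through \<open>(z / v) ^ m\<close>, the reciprocal of the coordinate
  \<open>W\<close>.\<close>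

lemma f_eq: "f z = z * (1 - (z / v) ^ m / of_nat m)"
proof -
  have "a * z ^ m = (a * v ^ m) * (z / v) ^ m" using v_nz by (simp add: power_divide)
  then have az: "a * z ^ m = - ((z / v) ^ m / of_nat m)" by (simp add: a_v)
  have "f z = z * (1 + a * z ^ m)" by (simp add: f algebra_simps)
  then show ?thesis unfolding az by simp
qed

lemma petal_chart_power:
  assumes "W \<noteq> 0"
  shows "(petal_chart m v W / v) ^ m = 1 / W"
proof -
  have "(petal_chart m v W / v) ^ m = exp (of_nat m * (- Ln W / of_nat m))"
    using v_nz by (simp only: petal_chart_def exp_of_nat_mult) simp
  also have "of_nat m * (- Ln W / of_nat m) = - Ln W" using m by simp
  also have "exp \<dots> = 1 / W" using assms by (simp add: exp_minus divide_inverse)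
  finally show ?thesis .
qed

lemma petal_chart_nz: "petal_chart m v W \<noteq> 0"
  using v_nz by (simp add: petal_chart_def)

lemma inj_petal_chart: "inj_on (petal_chart m v) (- \<real>\<^sub>\<le>\<^sub>0)"
proof (rule inj_onI)
  fix W W' assume W: "W \<in> - \<real>\<^sub>\<le>\<^sub>0" "W' \<in> - \<real>\<^sub>\<le>\<^sub>0"
    and eq: "petal_chart m v W = petal_chart m v W'"
  have nz: "W \<noteq> 0" "W' \<noteq> 0" using W by auto
  have "1 / W = 1 / W'"
    unfolding petal_chart_power[OF nz(1), symmetric] petal_chart_power[OF nz(2), symmetric] eq ..
  then show "W = W'" by simp
qed

lemma parabolic_basin_nz:
  assumes "z \<in> parabolic_basin f m v"
  shows "z \<noteq> 0"
proof -
  have "(f ^^ 0) z \<noteq> 0" using assms unfolding parabolic_basin_def by blast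
  then show ?thesis by simp
qed

lemma funpow_zero: "(f ^^ n) 0 = 0"
  by (induction n) (auto simp: f)

lemma continuous_on_funpow: "continuous_on UNIV (f ^^ n)"
proof (induction n)
  case (Suc n)
  have "continuous_on UNIV f" unfolding f by (intro continuous_intros)
  then show ?case using Suc
    by (auto intro!: continuous_on_compose2[of UNIV f])
qed (simp add: continuous_on_id)

text \<open>The second hypothesis says that the principal branch is kept during the step; it is then
  the form of \<open>f\<close> in \<open>f_eq\<close>.\<close>

lemma petal_chart_conjugates:
  assumes "W \<noteq> 0" "petal_chart m v (fatou_step m W) = petal_chart m v W * (1 - 1 / (of_nat m * W))"
  shows "f (petal_chart m v W) = petal_chart m v (fatou_step m W)"
  unfolding f_eq petal_chart_power[OF assms(1)] assms(2) by (simp add: divide_simps)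

lemma petal_chart_orbit:
  assumes "\<bar>\<beta>\<bar> < pi / 2" "R > 0"
    and "\<And>W. W \<in> half_plane \<beta> R \<Longrightarrow> fatou_step m W \<in> half_plane \<beta> R"
    and "\<And>W. W \<in> half_plane \<beta> R \<Longrightarrow>
       petal_chart m v (fatou_step m W) = petal_chart m v W * (1 - 1 / (of_nat m * W))"
    and W: "W \<in> half_plane \<beta> R"
  shows "(f ^^ n) (petal_chart m v W) = petal_chart m v ((fatou_step m ^^ n) W) \<and>
    (fatou_step m ^^ n) W \<in> half_plane \<beta> R"
proof (induction n)
  case (Suc n)
  let ?X = "(fatou_step m ^^ n) W"
  have X: "?X \<in> half_plane \<beta> R" using Suc by blast
  have "f (petal_chart m v ?X) = petal_chart m v (fatou_step m ?X)"
    using half_plane_Arg(1)[OF _ assms(1) X] assms(2) by (intro petal_chart_conjugates assms(4) X) auto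
  then show ?case using Suc assms(3)[OF X] by simp
qed (use W in auto)

text \<open>In the chart \<open>W n / n\<close> tends to 1, and taking the power
  \<open>-1 / m\<close> turns this into the required asymptotics
  \<open>root m n * z n \<longlonglongrightarrow> v\<close>. The last conclusion keeps orbits from
  the upper part off the attracting ray.\<close>

lemma petal_in_parabolic_basin:
  assumes "\<bar>\<beta>\<bar> < pi / 2"
  obtains R where "R > 0" "petal_chart m v ` half_plane \<beta> R \<subseteq> parabolic_basin f m v"
    "\<And>W n. W \<in> half_plane \<beta> R \<Longrightarrow> Im W > 0 \<Longrightarrow>
       \<exists>W'. Im W' > 0 \<and> (f ^^ n) (petal_chart m v W) = petal_chart m v W'"
proof -
  obtain R where R: "R > 0"
    "\<And>W. W \<in> half_plane \<beta> R \<Longrightarrow> fatou_step m W \<in> half_plane \<beta> R"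
    "\<And>W. W \<in> half_plane \<beta> R \<Longrightarrow>
       Re (cis (-\<beta>) * W) + cos \<beta> / 2 \<le> Re (cis (-\<beta>) * fatou_step m W)"
    "\<And>W. W \<in> half_plane \<beta> R \<Longrightarrow>
       petal_chart m v (fatou_step m W) = petal_chart m v W * (1 - 1 / (of_nat m * W))"
    "\<And>W. W \<in> half_plane \<beta> R \<Longrightarrow> Im W > 0 \<Longrightarrow> Im (fatou_step m W) > 0"
    using half_plane_invariant[OF m assms, of v] by blast
  have orbit: "(f ^^ n) (petal_chart m v W) = petal_chart m v ((fatou_step m ^^ n) W) \<and>
    (fatou_step m ^^ n) W \<in> half_plane \<beta> R" if "W \<in> half_plane \<beta> R" for W n
    by (rule petal_chart_orbit[OF assms R(1) _ _ that]; erule R)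
  show ?thesis
  proof (rule that[OF R(1)])
    show "petal_chart m v ` half_plane \<beta> R \<subseteq> parabolic_basin f m v"
    proof clarify
      fix W assume W: "W \<in> half_plane \<beta> R"
      let ?X = "\<lambda>n. (fatou_step m ^^ n) W"
      have lim: "(\<lambda>n. ?X n / of_nat n) \<longlonglongrightarrow> 1"
        by (rule fatou_orbit_asymp[OF m assms _ _ W]; erule R)
      have "(\<lambda>n. Ln (?X n / of_nat n)) \<longlonglongrightarrow> Ln 1" by (rule tendsto_Ln[OF lim]) simp
      then have "(\<lambda>n. v * exp (- Ln (?X n / of_nat n) / of_nat m)) \<longlonglongrightarrow> v * exp (- Ln 1 / of_nat m)"
        using m by (intro tendsto_mult tendsto_const tendsto_exp tendsto_divide tendsto_minus) auto
      moreover have "eventually (\<lambda>n. v * exp (- Ln (?X n / of_nat n) / of_nat m) =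
          of_real (root m (real n)) * (f ^^ n) (petal_chart m v W)) sequentially"
        using eventually_ge_at_top[of 1]
      proof eventually_elim
        case (elim n)
        have "?X n \<noteq> 0"
          using half_plane_Arg(1)[OF _ assms conjunct2[OF orbit[OF W]]] R(1) by simp
        then have "- Ln (?X n / of_nat n) / of_nat m =
            of_real (ln (real n)) / of_nat m + - Ln (?X n) / of_nat m"
          by (subst Ln_divide_of_nat[OF elim]) (simp_all add: diff_divide_distrib)
        then show ?case
          using orbit[OF W, of n] elim
          by (simp only: of_real_root_eq_exp[OF m] exp_add petal_chart_def mult_ac)
      qed
      ultimately have root: "(\<lambda>n. of_real (root m (real n)) * (f ^^ n) (petal_chart m v W)) \<longlonglongrightarrow> v"
        by (auto intro: Lim_transform_eventually)
      have "1 / real m > 0" using m by simp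
      then have "filterlim (\<lambda>n. real n powr (1 / real m)) at_top sequentially" by real_asymp
      moreover have "eventually (\<lambda>n. real n powr (1 / real m) = root m (real n)) sequentially"
        using eventually_ge_at_top[of 1] by eventually_elim (use m in \<open>simp add: root_powr_inverse\<close>)
      ultimately have "filterlim (\<lambda>n. root m (real n)) at_top sequentially"
        by (rule filterlim_mono_eventually[OF _ order_refl order_refl])
      then have "filterlim (\<lambda>n. complex_of_real (root m (real n))) at_infinity sequentially"
        by (rule filterlim_compose[OF filterlim_of_real_at_infinity])
      with root have "(\<lambda>n. of_real (root m (real n)) * (f ^^ n) (petal_chart m v W) /
          of_real (root m (real n))) \<longlonglongrightarrow> 0"
        by (rule tendsto_divide_0)
      moreover have "eventually (\<lambda>n. of_real (root m (real n)) * (f ^^ n) (petal_chart m v W) /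
          of_real (root m (real n)) = (f ^^ n) (petal_chart m v W)) sequentially"
        using eventually_ge_at_top[of 1] by eventually_elim (use m in auto)
      ultimately have "(\<lambda>n. (f ^^ n) (petal_chart m v W)) \<longlonglongrightarrow> 0"
        by (rule Lim_transform_eventually)
      with root show "petal_chart m v W \<in> parabolic_basin f m v"
        using orbit[OF W] petal_chart_nz
        by (auto simp: parabolic_basin_def converges_from_direction_def)
    qed
  next
    fix W n assume W: "W \<in> half_plane \<beta> R" "Im W > 0"
    have "Im ((fatou_step m ^^ n) W) > 0"
      by (induction n) (use W R(5) orbit[OF W(1)] in auto)
    then show "\<exists>W'. Im W' > 0 \<and> (f ^^ n) (petal_chart m v W) = petal_chart m v W'"
      using orbit[OF W(1)] by blast
  qed
qed

text \<open>The rescaled orbit \<open>y n\<close> tends to 1, so \<open>W n = n / y n ^ m\<close>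
  grows like \<open>n\<close>, and its component along the normal exceeds every
  \<open>R\<close>.\<close>

lemma parabolic_basin_eventually_in_petal:
  assumes "\<bar>\<beta>\<bar> < pi / 2" "z \<in> parabolic_basin f m v"
  shows "eventually (\<lambda>n. (f ^^ n) z \<in> petal_chart m v ` half_plane \<beta> R) sequentially"
proof -
  have c: "cos \<beta> > 0" using assms by (intro cos_gt_zero_pi) auto
  define y where "y = (\<lambda>n. of_real (root m (real n)) * (f ^^ n) z / v)"
  define W where "W = (\<lambda>n. of_nat n * exp (- (of_nat m * Ln (y n))))"
  have "(\<lambda>n. of_real (root m (real n)) * (f ^^ n) z) \<longlonglongrightarrow> v"
    using assms(2) by (auto simp: parabolic_basin_def converges_from_direction_def)
  then have "y \<longlonglongrightarrow> v / v" unfolding y_def by (intro tendsto_intros v_nz)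
  then have y: "y \<longlonglongrightarrow> 1" using v_nz by simp
  then have L: "(\<lambda>n. of_nat m * Ln (y n)) \<longlonglongrightarrow> of_nat m * Ln 1" by (intro tendsto_intros) auto
  \<comment> \<open>This makes \<open>ln n - m * Ln (y n)\<close> the principal logarithm of
    \<open>W n\<close>, so that \<open>petal_chart\<close> returns the orbit point itself.\<close>
  have 1: "eventually (\<lambda>n. norm (of_nat m * Ln (y n)) < pi) sequentially"
    using tendstoD[OF L, of pi] by simp
  have "(\<lambda>n. Re (cis (-\<beta>) * exp (- (of_nat m * Ln (y n))))) \<longlonglongrightarrow> Re (cis (-\<beta>) * exp (- (of_nat m * Ln 1)))"
    by (intro tendsto_intros L)
  then have 2: "eventually (\<lambda>n. Re (cis (-\<beta>) * exp (- (of_nat m * Ln (y n)))) > cos \<beta> / 2) sequentially"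
    by (rule order_tendstoD) (use c in simp)
  have "filterlim (\<lambda>n. real n * (cos \<beta> / 2)) at_top sequentially" using c by real_asymp
  then have 3: "eventually (\<lambda>n. real n * (cos \<beta> / 2) > R) sequentially"
    by (simp add: filterlim_at_top_dense)
  show ?thesis using 1 2 3 eventually_ge_at_top[of 1]
  proof eventually_elim
    case (elim n)
    have nz: "(f ^^ n) z \<noteq> 0" using assms by (auto simp: parabolic_basin_def)
    have "Re (cis (-\<beta>) * W n) = real n * Re (cis (-\<beta>) * exp (- (of_nat m * Ln (y n))))"
      by (simp add: W_def algebra_simps)
    also have "\<dots> \<ge> real n * (cos \<beta> / 2)" using elim(2) by (intro mult_left_mono) auto
    finally have "W n \<in> half_plane \<beta> R" using elim(3) by (simp add: half_plane_def)
    moreover have "petal_chart m v (W n) = (f ^^ n) z"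
    proof -
      have "y n \<noteq> 0" using nz elim(4) m v_nz by (auto simp: y_def)
      have "\<bar>Im (of_nat m * Ln (y n))\<bar> < pi"
        using elim(1) abs_Im_le_cmod order.strict_trans1 by blast
      moreover have "exp (of_real (ln (real n)) - of_nat m * Ln (y n)) = W n"
        using elim(4) by (simp add: W_def exp_diff exp_minus exp_of_real divide_inverse)
      ultimately have "Ln (W n) = of_real (ln (real n)) - of_nat m * Ln (y n)"
        by (intro Ln_unique) auto
      then have "- Ln (W n) / of_nat m = Ln (y n) - of_real (ln (real n)) / of_nat m"
        using m by (simp add: field_simps)
      then have "petal_chart m v (W n) = v * (y n / of_real (root m (real n)))"
        by (simp only: petal_chart_def exp_diff exp_Ln[OF \<open>y n \<noteq> 0\<close>] of_real_root_eq_exp[OF m elim(4)])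
      then show ?thesis using elim(4) m v_nz by (simp add: y_def)
    qed
    ultimately show ?case by (metis imageI)
  qed
qed

text \<open>An index shift does not affect the asymptotics, because
  \<open>root m ((k + n) / k)\<close> tends to 1. An orbit that reaches 0 stays there, so no earlier
  point can be 0.\<close>

lemma funpow_in_parabolic_basin_imp:
  assumes b: "(f ^^ n) z \<in> parabolic_basin f m v"
  shows "z \<in> parabolic_basin f m v"
proof -
  have shift: "(f ^^ k) ((f ^^ n) z) = (f ^^ (k + n)) z" for k by (simp add: funpow_add)
  have nz: "(f ^^ k) z \<noteq> 0" for k
  proof
    assume "(f ^^ k) z = 0"
    then have "(f ^^ n) ((f ^^ k) z) = 0" by (simp add: funpow_zero)
    then have "(f ^^ k) ((f ^^ n) z) = 0"
      by (simp add: funpow_add[symmetric, unfolded fun_eq_iff o_def, rule_format] add.commute)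
    then show False using b by (auto simp: parabolic_basin_def)
  qed
  have 0: "(\<lambda>k. (f ^^ k) z) \<longlonglongrightarrow> 0"
    using b LIMSEQ_offset[of "\<lambda>k. (f ^^ k) z" n]
    by (auto simp: parabolic_basin_def converges_from_direction_def shift)
  have "(\<lambda>k. (real k + real n) / real k) \<longlonglongrightarrow> 1" by real_asymp
  then have "(\<lambda>k. root m ((real k + real n) / real k)) \<longlonglongrightarrow> root m 1"
    by (rule tendsto_real_root)
  then have "(\<lambda>k. complex_of_real (root m ((real k + real n) / real k))) \<longlonglongrightarrow> of_real (root m 1)"
    by (rule tendsto_of_real)
  moreover have "(\<lambda>k. of_real (root m (real k)) * (f ^^ (k + n)) z) \<longlonglongrightarrow> v"
    using b by (auto simp: parabolic_basin_def converges_from_direction_def shift)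
  ultimately have "(\<lambda>k. complex_of_real (root m ((real k + real n) / real k)) *
      (of_real (root m (real k)) * (f ^^ (k + n)) z)) \<longlonglongrightarrow> of_real (root m 1) * v"
    by (rule tendsto_mult)
  moreover have "eventually (\<lambda>k. complex_of_real (root m ((real k + real n) / real k)) *
      (of_real (root m (real k)) * (f ^^ (k + n)) z) =
      of_real (root m (real (k + n))) * (f ^^ (k + n)) z) sequentially"
    using eventually_ge_at_top[of 1] by eventually_elim (use m in \<open>simp add: real_root_divide\<close>)
  ultimately have "(\<lambda>k. of_real (root m (real (k + n))) * (f ^^ (k + n)) z) \<longlonglongrightarrow> v"
    using m by (auto intro: Lim_transform_eventually)
  then have "(\<lambda>k. of_real (root m (real k)) * (f ^^ k) z) \<longlonglongrightarrow> v"
    by (rule LIMSEQ_offset)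
  with nz 0 show "z \<in> parabolic_basin f m v"
    by (simp add: parabolic_basin_def converges_from_direction_def)
qed

text \<open>Every orbit in the basin enters the open image of a half-plane, so the basin is a union
  of preimages of this image under iterates.\<close>

lemma open_parabolic_basin: "open (parabolic_basin f m v)"
proof (rule topological_space_class.openI)
  fix z assume z: "z \<in> parabolic_basin f m v"
  obtain R where R: "R > 0" "petal_chart m v ` half_plane 0 R \<subseteq> parabolic_basin f m v"
    by (rule petal_in_parabolic_basin[of 0]) auto
  obtain n where n: "(f ^^ n) z \<in> petal_chart m v ` half_plane 0 R"
    using eventually_happens'[OF sequentially_bot parabolic_basin_eventually_in_petal[of 0 z R]] z
    by auto
  have sub: "half_plane 0 R \<subseteq> - \<real>\<^sub>\<le>\<^sub>0" using R by (intro half_plane_not_nonpos_Reals) auto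
  have "open (petal_chart m v ` half_plane 0 R)"
    by (rule open_mapping_thm3[OF holomorphic_on_subset[OF petal_chart_holomorphic sub]
          open_half_plane inj_on_subset[OF inj_petal_chart sub]])
  then have "open ((f ^^ n) -` (petal_chart m v ` half_plane 0 R))"
    by (intro open_vimage continuous_on_funpow)
  moreover have "(f ^^ n) -` (petal_chart m v ` half_plane 0 R) \<subseteq> parabolic_basin f m v"
    using R(2) funpow_in_parabolic_basin_imp by blast
  ultimately show "\<exists>T. open T \<and> z \<in> T \<and> T \<subseteq> parabolic_basin f m v" using n by blast
qed

text \<open>Here \<open>f\<close> multiplies \<open>z\<close> by a real factor greater than 1. The
  orbit stays on its ray and its modulus never falls below \<open>norm z\<close>.\<close>

lemma repelling_ray_not_in_basin:
  assumes "s > 0" "(z / v) ^ m = - of_real s"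
  shows "z \<notin> parabolic_basin f m v"
proof
  assume z: "z \<in> parabolic_basin f m v"
  have ray: "\<exists>t>0. ((f ^^ k) z / v) ^ m = - of_real t \<and> norm ((f ^^ k) z) \<ge> norm z" for k
  proof (induction k)
    case (Suc k)
    then obtain t where t: "t > 0" "((f ^^ k) z / v) ^ m = - of_real t" "norm ((f ^^ k) z) \<ge> norm z"
      by blast
    have eq: "f ((f ^^ k) z) = (f ^^ k) z * of_real (1 + t / real m)"
      by (simp add: f_eq t(2))
    have "norm ((f ^^ k) z) * 1 \<le> norm ((f ^^ k) z) * (1 + t / real m)"
      using t(1) by (intro mult_left_mono) auto
    also have "\<dots> = norm (f ((f ^^ k) z))"
      using t(1) by (simp only: eq norm_mult norm_of_real) simp
    finally have "norm (f ((f ^^ k) z)) \<ge> norm z" using t(3) by simp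
    moreover have "(f ((f ^^ k) z) / v) ^ m = ((f ^^ k) z / v) ^ m * of_real (1 + t / real m) ^ m"
      by (simp only: eq power_mult_distrib[symmetric] times_divide_eq_left)
    then have "(f ((f ^^ k) z) / v) ^ m = - of_real (t * (1 + t / real m) ^ m)"
      by (simp add: t(2))
    moreover have "t * (1 + t / real m) ^ m > 0" using t(1) by (intro mult_pos_pos zero_less_power) (auto intro: add_pos_nonneg)
    ultimately show ?case by auto
  qed (use assms in auto)
  have "z \<noteq> 0" by (rule parabolic_basin_nz[OF z])
  moreover have "(\<lambda>k. norm ((f ^^ k) z)) \<longlonglongrightarrow> 0"
    using z by (auto simp: parabolic_basin_def converges_from_direction_def intro: tendsto_norm_zero)
  then have "norm z \<le> 0" by (rule LIMSEQ_le_const) (use ray in blast)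
  ultimately show False by simp
qed

text \<open>The bounding rays of the sector miss the basin, and the orbit of \<open>z\<close> stays
  in \<open>\<Omega>\<close> and eventually enters the sector. Connectedness of
  \<open>\<Omega>\<close> then puts \<open>z\<close> in the sector too.\<close>

lemma immediate_basin_sector:
  assumes "immediate_basin f m v \<Omega>" "z \<in> \<Omega>"
  shows "z \<noteq> 0" "\<bar>Arg (z / v)\<bar> < pi / real m"
proof -
  have comp: "\<Omega> \<in> components (parabolic_basin f m v)" and inv: "f ` \<Omega> \<subseteq> \<Omega>"
    using assms by (auto simp: immediate_basin_def)
  have sub: "\<Omega> \<subseteq> parabolic_basin f m v" by (rule in_components_subset[OF comp])
  have nz: "w \<noteq> 0" if "w \<in> \<Omega>" for w
    using sub that parabolic_basin_nz by blast
  show "z \<noteq> 0" by (rule nz[OF assms(2)])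
  have pm: "0 < pi / real m" "pi / real m \<le> pi" using m by (auto simp: divide_simps)
  \<comment> \<open>A continuous substitute for the discontinuous \<open>Arg\<close>: away from 0 it
    is positive exactly inside the sector and vanishes exactly on its bounding rays.\<close>
  define c where "c = (\<lambda>w. Re (w / v) - norm (w / v) * cos (pi / real m))"
  have c_Arg: "c w = norm (w / v) * (cos \<bar>Arg (w / v)\<bar> - cos (pi / real m))" for w
  proof -
    have "Re (w / v) = norm (w / v) * cos (Arg (w / v))"
      using Re_cis_mult[of 0 "w / v"] by (simp only: minus_zero cis_zero mult_1 diff_zero)
    then show ?thesis unfolding c_def by (simp only: cos_abs_real right_diff_distrib)
  qed
  have c_nz: "c w \<noteq> 0" if w: "w \<in> \<Omega>" for w
  proof
    assume "c w = 0"
    moreover have "norm (w / v) \<noteq> 0" using nz[OF w] v_nz by simp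
    ultimately have "cos \<bar>Arg (w / v)\<bar> = cos (pi / real m)"
      unfolding c_Arg mult_eq_0_iff by linarith
    then have Arg: "\<bar>Arg (w / v)\<bar> = pi / real m"
      using pm Arg_bounded[of "w / v"] by (rule_tac cos_inj_pi) auto
    have "(w / v) ^ m = rcis (norm (w / v)) (Arg (w / v)) ^ m"
      by (simp only: rcis_cmod_Arg)
    also have "\<dots> = of_real (norm (w / v) ^ m) * cis (real m * Arg (w / v))"
      by (simp only: DeMoivre2) (simp only: rcis_def)
    also have "cis (real m * Arg (w / v)) = -1"
    proof -
      have "real m * Arg (w / v) = pi \<or> real m * Arg (w / v) = - pi"
        using Arg m by (auto simp: abs_if field_simps split: if_splits)
      then show ?thesis by (auto simp: complex_eq_iff)
    qed
    finally have "(w / v) ^ m = - of_real (norm (w / v) ^ m)" by simp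
    moreover have "norm (w / v) ^ m > 0" using nz[OF w] v_nz by simp
    ultimately show False using repelling_ray_not_in_basin sub w by blast
  qed
  have "(\<lambda>n. of_real (root m (real n)) * (f ^^ n) z) \<longlonglongrightarrow> v"
    using sub assms(2) by (auto simp: parabolic_basin_def converges_from_direction_def)
  then have "(\<lambda>n. c (of_real (root m (real n)) * (f ^^ n) z)) \<longlonglongrightarrow> c v"
    unfolding c_def by (intro tendsto_intros v_nz)
  moreover have "cos (pi / real m) < cos 0" using pm by (intro cos_monotone_0_pi) auto
  then have "c v > 0" using v_nz by (simp add: c_def)
  ultimately have "eventually (\<lambda>n. c (of_real (root m (real n)) * (f ^^ n) z) > 0) sequentially"
    by (rule order_tendstoD(1))
  then obtain n where n: "n \<ge> 1" "c (of_real (root m (real n)) * (f ^^ n) z) > 0"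
    using eventually_happens'[OF sequentially_bot eventually_conj[OF eventually_ge_at_top[of 1]]]
    by blast
  \<comment> \<open>Homogeneity removes the normalizing root, so the sign of \<open>c\<close> passes
    to the orbit point.\<close>
  have homog: "c (of_real r * w) = r * c w" if "r \<ge> 0" for r w
  proof -
    have "c (of_real r * w) = Re (of_real r * (w / v)) - norm (of_real r * (w / v)) * cos (pi / real m)"
      by (simp only: c_def times_divide_eq_right)
    also have "\<dots> = r * c w"
      using that by (simp only: c_def norm_mult norm_of_real Re_complex_of_real Im_complex_of_real
          times_complex.sel) (simp add: right_diff_distrib)
    finally show ?thesis .
  qed
  have root: "root m (real n) > 0" using n m by simp
  then have "root m (real n) * c ((f ^^ n) z) > 0"
    using n(2) homog[of "root m (real n)"] by simp
  then have pos: "c ((f ^^ n) z) > 0" using root by (rule zero_less_mult_pos)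
  have orbit: "(f ^^ k) z \<in> \<Omega>" for k by (induction k) (use inv assms(2) in auto)
  have "connected (c ` \<Omega>)"
    unfolding c_def using v_nz
    by (intro connected_continuous_image in_components_connected[OF comp] continuous_intros) auto
  have "c z > 0"
  proof (rule ccontr)
    assume "\<not> c z > 0"
    then have "0 \<in> c ` \<Omega>"
      using pos by (intro connectedD_interval[OF \<open>connected (c ` \<Omega>)\<close> imageI[OF assms(2)] imageI[OF orbit[of n]]]) auto
    then show False using c_nz by auto
  qed
  moreover have "norm (z / v) > 0" using \<open>z \<noteq> 0\<close> v_nz by simp
  ultimately have "cos \<bar>Arg (z / v)\<bar> - cos (pi / real m) > 0"
    unfolding c_Arg by (rule zero_less_mult_pos)
  then show "\<bar>Arg (z / v)\<bar> < pi / real m"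
    using pm Arg_bounded[of "z / v"] cos_mono_less_eq[of "pi / real m" "\<bar>Arg (z / v)\<bar>"]
    by linarith
qed

text \<open>The image of the half-plane is connected and meets \<open>\<Omega>\<close>, because an
  orbit starting in the invariant component \<open>\<Omega>\<close> is eventually in it.\<close>

lemma petal_in_immediate_basin:
  assumes \<Omega>: "immediate_basin f m v \<Omega>" and "\<bar>\<beta>\<bar> < pi / 2" "R > 0"
    and sub: "petal_chart m v ` half_plane \<beta> R \<subseteq> parabolic_basin f m v"
  shows "petal_chart m v ` half_plane \<beta> R \<subseteq> \<Omega>"
proof (rule components_maximal)
  show comp: "\<Omega> \<in> components (parabolic_basin f m v)" using \<Omega> by (simp add: immediate_basin_def)
  have "half_plane \<beta> R \<subseteq> - \<real>\<^sub>\<le>\<^sub>0" using assms by (intro half_plane_not_nonpos_Reals) auto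
  then show "connected (petal_chart m v ` half_plane \<beta> R)"
    by (intro connected_continuous_image connected_half_plane holomorphic_on_imp_continuous_on
        holomorphic_on_subset[OF petal_chart_holomorphic])
  obtain z where z: "z \<in> \<Omega>" using in_components_nonempty[OF comp] by blast
  then have "z \<in> parabolic_basin f m v" using in_components_subset[OF comp] by blast
  from parabolic_basin_eventually_in_petal[OF assms(2) this, of R]
  obtain n where "(f ^^ n) z \<in> petal_chart m v ` half_plane \<beta> R"
    using eventually_happens'[OF sequentially_bot] by blast
  moreover have "(f ^^ n) z \<in> \<Omega>"
    by (induction n) (use \<Omega> z in \<open>auto simp: immediate_basin_def\<close>)
  ultimately show "\<Omega> \<inter> petal_chart m v ` half_plane \<beta> R \<noteq> {}" by blast
qed (rule sub)

end

subsection \<open>Distance to the grand orbit\<close>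

text \<open>On the sector this is \<open>Ln W / 2\<close> for \<open>W = (v / z) ^ m\<close>; the
  factor one half gives a strip of width \<open>pi\<close>, which \<open>exp\<close> maps to a
  half-plane.\<close>

definition strip_chart :: "nat \<Rightarrow> complex \<Rightarrow> complex \<Rightarrow> complex" where
  "strip_chart m v z = - (of_nat m / 2) * Ln (z / v)"

context parabolic_germ
begin

lemma Im_strip_chart:
  assumes "z \<noteq> 0"
  shows "Im (strip_chart m v z) = - (real m / 2) * Arg (z / v)"
  using assms v_nz by (simp add: strip_chart_def Arg_eq_Im_Ln)

lemma strip_chart_in_strip:
  assumes "immediate_basin f m v \<Omega>" "z \<in> \<Omega>"
  shows "\<bar>Im (strip_chart m v z)\<bar> < pi / 2"
  using immediate_basin_sector[OF assms] m by (simp add: Im_strip_chart abs_mult field_simps)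

lemma strip_chart_holomorphic:
  assumes "immediate_basin f m v \<Omega>"
  shows "strip_chart m v holomorphic_on \<Omega>"
proof -
  have "z / v \<notin> \<real>\<^sub>\<le>\<^sub>0" if "z \<in> \<Omega>" for z
  proof
    assume neg: "z / v \<in> \<real>\<^sub>\<le>\<^sub>0"
    note sector = immediate_basin_sector[OF assms that]
    have "pi / real m \<le> pi" using m by (simp add: divide_simps)
    then have "Arg (z / v) < pi" using sector(2) by linarith
    moreover have "Re (z / v) \<le> 0" "Im (z / v) = 0"
      using neg by (auto simp: complex_nonpos_Reals_iff)
    moreover have "z / v \<noteq> 0" using sector(1) v_nz by simp
    then have "Re (z / v) \<noteq> 0" using \<open>Im (z / v) = 0\<close> complex_eqI[of "z / v" 0] by auto
    ultimately show False using Arg_eq_pi[of "z / v"] by linarith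
  qed
  then show ?thesis unfolding strip_chart_def using v_nz by (intro holomorphic_intros) auto
qed

lemma strip_chart_petal_chart:
  assumes "W \<noteq> 0" "\<bar>Arg W\<bar> < pi"
  shows "strip_chart m v (petal_chart m v W) = Ln W / 2"
proof -
  have Im: "\<bar>Im (- Ln W / of_nat m)\<bar> < pi"
  proof -
    have "\<bar>Im (- Ln W / of_nat m)\<bar> = \<bar>Arg W\<bar> / real m"
      using assms by (simp add: Arg_eq_Im_Ln)
    also have "\<dots> \<le> \<bar>Arg W\<bar> / 1" using m by (intro divide_left_mono) auto
    finally show ?thesis using assms(2) by simp
  qed
  have "Ln (petal_chart m v W / v) = - Ln W / of_nat m"
  proof (rule Ln_unique)
    show "exp (- Ln W / of_nat m) = petal_chart m v W / v" using v_nz by (simp add: petal_chart_def)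
  qed (use Im in linarith)+
  then show ?thesis using m by (simp add: strip_chart_def)
qed

lemma petal_chart_exp_strip_chart:
  assumes "z \<noteq> 0" "\<bar>Im (strip_chart m v z)\<bar> < pi / 2"
  shows "petal_chart m v (exp (2 * strip_chart m v z)) = z"
proof -
  have "Ln (exp (2 * strip_chart m v z)) = 2 * strip_chart m v z"
    using assms by (intro Ln_exp) auto
  then have "- Ln (exp (2 * strip_chart m v z)) / of_nat m = Ln (z / v)"
    using m by (simp add: strip_chart_def)
  then show ?thesis using assms v_nz by (simp only: petal_chart_def exp_Ln divide_eq_0_iff) simp
qed

text \<open>By \<open>f_eq\<close> the multiplier at a real multiple of \<open>v\<close> is real;
  \<open>t'\<close> may have either sign.\<close>

lemma attracting_ray_invariant: "\<exists>t'. (f ^^ k) (of_real t * v) = of_real t' * v"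
proof (induction k)
  case (Suc k)
  then obtain t' where "(f ^^ k) (of_real t * v) = of_real t' * v" by blast
  then have "(f ^^ Suc k) (of_real t * v) = of_real (t' * (1 - t' ^ m / real m)) * v"
    using v_nz by (simp add: f_eq)
  then show ?case by blast
qed auto

end

text \<open>The argument differs from that of the normal by less than \<open>pi / 2 - e\<close>, so
  the component along the normal exceeds \<open>norm W * sin e\<close>.\<close>

lemma in_half_plane_of_Arg:
  assumes "0 < e" "e < pi / 2" "0 < Arg W" "Arg W < pi - 2 * e" "R / sin e < norm W"
  shows "W \<in> half_plane (pi / 2 - e) R"
proof -
  have sin: "sin e > 0" using assms by (intro sin_gt_zero) auto
  have "sin e = cos (pi / 2 - e)" by (simp add: sin_cos_eq)
  also have "\<dots> < cos \<bar>Arg W - (pi / 2 - e)\<bar>"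
    using assms by (intro cos_monotone_0_pi) auto
  also have "\<dots> = cos (Arg W - (pi / 2 - e))" by (rule cos_abs_real)
  finally have cos: "sin e < cos (Arg W - (pi / 2 - e))" .
  have "W \<noteq> 0" using assms(3) by (auto simp: Arg_zero)
  have "R < norm W * sin e" using assms(5) sin by (simp add: pos_divide_less_eq)
  also have "\<dots> < norm W * cos (Arg W - (pi / 2 - e))"
    using cos \<open>W \<noteq> 0\<close> by (intro mult_strict_left_mono) auto
  finally show ?thesis unfolding half_plane_def mem_Collect_eq Re_cis_mult .
qed

section \<open>Choice of the base point and case distinction\<close>

theorem theoremB:
  fixes f :: "complex \<Rightarrow> complex" and m :: nat and a v q :: complex
    and \<Omega> P :: "complex set" and C :: real
  assumes "m \<ge> 1" and "a \<noteq> 0"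
    and "\<And>z. f z = z + a * z ^ (m + 1)"
    and "attraction_vector a m v"
    and "immediate_basin f m v \<Omega>"
    and "attracting_petal f m v P"
    and "C > 0"
    and "q \<in> P" and "q \<in> {of_real t * v | t. t > 0}"
  shows "\<exists>z0\<in>\<Omega>. \<forall>q'\<in>(\<Union>l. \<Union>k. (f ^^ l) -` {(f ^^ k) q}) \<inter> \<Omega>.
           kobayashi_dist \<Omega> z0 q' \<ge> ennreal C"
proof -
  interpret parabolic_germ f m a v by standard (use assms in auto)
  note \<Omega> = \<open>immediate_basin f m v \<Omega>\<close>
  have "open \<Omega>"
    using \<Omega> open_components[OF open_parabolic_basin] by (simp add: immediate_basin_def)
  define X where "X = strip_chart m v"
  have X: "X holomorphic_on \<Omega>" "\<And>z. z \<in> \<Omega> \<Longrightarrow> \<bar>Im (X z)\<bar> < pi / 2"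
    using strip_chart_holomorphic[OF \<Omega>] strip_chart_in_strip[OF \<Omega>] by (auto simp: X_def)
  note dist = kobayashi_dist_ge_strip[OF \<open>open \<Omega>\<close> X]
  \<comment> \<open>Distances to the upper edge of the strip: \<open>e0\<close> for the base point,
    \<open>pi / 2\<close> for the real axis and \<open>e1\<close> for a level nearer the edge. Each
    factor \<open>exp (- 2 * C)\<close> costs Kobayashi distance at least \<open>C\<close>.\<close>
  define e0 where "e0 = pi / 2 * exp (- 2 * C)"
  define e1 where "e1 = e0 * exp (- 2 * C)"
  have scaled: "0 < x * exp (- 2 * C)" "x * exp (- 2 * C) < x" "ln (x * exp (- 2 * C)) = ln x - 2 * C"
    if "x > 0" for x :: real
    using that \<open>C > 0\<close> by (simp_all add: ln_mult)
  have e0: "0 < e0" "e0 < pi / 2" "ln e0 = ln (pi / 2) - 2 * C"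
    unfolding e0_def by (rule scaled; simp)+
  have e1: "0 < e1" "e1 < e0" "ln e1 = ln e0 - 2 * C"
    unfolding e1_def by (rule scaled; rule e0)+
  \<comment> \<open>With this tilt the half-plane contains all sufficiently large \<open>W\<close>
    with \<open>0 < Arg W < pi - 2 * e1\<close>, that is, with \<open>Im X\<close> between 0 and
    \<open>pi / 2 - e1\<close>.\<close>
  have \<beta>: "\<bar>pi / 2 - e1\<bar> < pi / 2" using e0 e1 by auto
  obtain R where R: "R > 0" "petal_chart m v ` half_plane (pi / 2 - e1) R \<subseteq> parabolic_basin f m v"
    "\<And>W n. W \<in> half_plane (pi / 2 - e1) R \<Longrightarrow> Im W > 0 \<Longrightarrow>
       \<exists>W'. Im W' > 0 \<and> (f ^^ n) (petal_chart m v W) = petal_chart m v W'"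
    using petal_in_parabolic_basin[OF \<beta>] by blast
  define r where "r = R / sin e1"
  have r: "r > 0" using R(1) e0 e1 unfolding r_def by (intro divide_pos_pos sin_gt_zero) auto
  \<comment> \<open>The argument gives \<open>Im X = pi / 2 - e0\<close>. The modulus gives
    \<open>Re X = ln r / 2 + 2 * C\<close>, which is at distance at least \<open>C\<close> from the
    level \<open>Re X = ln r / 2\<close>.\<close>
  define W0 where "W0 = rcis (r * exp (4 * C)) (pi - 2 * e0)"
  have normW0: "norm W0 = r * exp (4 * C)" using r by (simp add: W0_def)
  have ArgW0: "Arg W0 = pi - 2 * e0"
    unfolding W0_def using r e0 by (intro Arg_unique'[of "r * exp (4 * C)"]) (auto simp: rcis_def cis_conv_exp)
  have "W0 \<noteq> 0" using r by (simp add: W0_def)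
  have "r * 1 < r * exp (4 * C)" using r \<open>C > 0\<close> by (intro mult_strict_left_mono) auto
  then have "W0 \<in> half_plane (pi / 2 - e1) R"
    using e0 e1 ArgW0 normW0 by (intro in_half_plane_of_Arg) (auto simp: r_def[symmetric])
  then have z0: "petal_chart m v W0 \<in> \<Omega>"
    using petal_in_immediate_basin[OF \<Omega> \<beta> R(1,2)] by blast
  have X0: "X (petal_chart m v W0) = Ln W0 / 2"
    unfolding X_def using \<open>W0 \<noteq> 0\<close> ArgW0 e0 by (intro strip_chart_petal_chart) auto
  have Im0: "Im (X (petal_chart m v W0)) = pi / 2 - e0"
    using \<open>W0 \<noteq> 0\<close> by (simp add: X0 Arg_eq_Im_Ln[symmetric] ArgW0 field_simps)
  have Re0: "Re (X (petal_chart m v W0)) = ln r / 2 + 2 * C"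
    using \<open>W0 \<noteq> 0\<close> r by (simp add: X0 normW0 ln_mult field_simps)
  show ?thesis
  proof (intro bexI[OF _ z0] ballI)
    fix q' assume "q' \<in> (\<Union>l. \<Union>k. (f ^^ l) -` {(f ^^ k) q}) \<inter> \<Omega>"
    then obtain l k where q': "(f ^^ l) q' = (f ^^ k) q" "q' \<in> \<Omega>" by auto
    note strip = X(2)[OF q'(2)]
    \<comment> \<open>The first three cases leave a box around the base point and cost at least
      \<open>C\<close>; the box itself contains no point of the grand orbit.\<close>
    consider "Im (X q') \<le> 0" | "Im (X q') \<ge> pi / 2 - e1" | "Re (X q') \<le> ln r / 2"
      | "Im (X q') > 0" "Im (X q') < pi / 2 - e1" "Re (X q') > ln r / 2"
      by linarith
    then show "ennreal C \<le> kobayashi_dist \<Omega> (petal_chart m v W0) q'"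
    proof cases
      case 1
      then have "ln (pi / 2) \<le> ln (pi / 2 - Im (X q'))"
        using strip by (subst ln_le_cancel_iff) auto
      then have "C \<le> \<bar>ln (pi / 2 - Im (X q')) - ln (pi / 2 - Im (X (petal_chart m v W0)))\<bar> / 2"
        using e0 by (simp add: Im0)
      then show ?thesis using dist(2) ennreal_leI order_trans by blast
    next
      case 2
      then have "ln (pi / 2 - Im (X q')) \<le> ln e1" using strip e1 by (subst ln_le_cancel_iff) auto
      then have "C \<le> \<bar>ln (pi / 2 - Im (X q')) - ln (pi / 2 - Im (X (petal_chart m v W0)))\<bar> / 2"
        using e1 by (simp add: Im0)
      then show ?thesis using dist(2) ennreal_leI order_trans by blast
    next
      case 3
      then have "C \<le> \<bar>Re (X q') - Re (X (petal_chart m v W0))\<bar> / 2"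
        by (simp add: Re0)
      then show ?thesis using dist(1) ennreal_leI order_trans by blast
    next
      case 4
      define W where "W = exp (2 * X q')"
      have "Ln W = 2 * X q'" unfolding W_def using strip by (intro Ln_exp) auto
      then have Arg: "Arg W = 2 * Im (X q')" by (subst Arg_eq_Im_Ln) (auto simp: W_def)
      have "r = exp (ln r)" using r by simp
      also have "\<dots> < norm W" using 4 by (simp add: W_def)
      finally have "W \<in> half_plane (pi / 2 - e1) R"
        using 4 e0 e1 by (intro in_half_plane_of_Arg) (auto simp: Arg r_def)
      moreover have "Im W > 0"
        unfolding W_def Im_exp using 4 strip by (intro mult_pos_pos sin_gt_zero) auto
      moreover have "petal_chart m v W = q'"
        unfolding W_def X_def
        using strip immediate_basin_sector(1)[OF \<Omega> q'(2)]
        by (intro petal_chart_exp_strip_chart) (auto simp: X_def)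
      ultimately obtain W' where W': "Im W' > 0" "(f ^^ l) q' = petal_chart m v W'"
        using R(3)[of W l] by auto
      \<comment> \<open>The common point of the two orbits is a real multiple of \<open>v\<close>,
        so its coordinate \<open>W'\<close> is real, contrary to \<open>Im W' > 0\<close>.\<close>
      obtain t where t: "(f ^^ k) q = of_real t * v"
        using attracting_ray_invariant assms(9) by blast
      have "W' \<noteq> 0" using W'(1) by auto
      then have "inverse W' = (of_real t * v / v) ^ m"
        using petal_chart_power[of W'] W'(2) q'(1) t by (simp add: inverse_eq_divide)
      also have "\<dots> = of_real (t ^ m)" using v_nz by simp
      finally have "W' = of_real (inverse (t ^ m))"
        by (subst inverse_inverse_eq[symmetric]) (simp only: of_real_inverse)
      then show ?thesis using W'(1) by simp
    qed
  qed
qed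

end
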